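(* Let $A \in M_n$. Then $$\min\{\nu(e^{i\xi}A + e^{-i\xi}A^* ) : \xi \in [0,2\pi)\} = \max\{\dim \mathbf{V} : \mathbf{V} \text{ is a totally isotropic subspace of } A\}.$$
   Context: $M_n$ is the algebra of $n \times n$ complex matrices and $A^*$ is the conjugate transpose of $A$. For a Hermitian matrix $H$, $\nu(H)$ denotes the number of nonnegative eigenvalues of $H$ (counted with multiplicity). A (complex linear) subspace $\mathbf{V}$ of $\mathbb{C}^n$ is a totally isotropic subspace of $A$ if $x^*Ay = 0$ for all $x, y \in \mathbf{V}$. *)

theory Defs
  imports "HOL-Analysis.Analysis" "HOL-Computational_Algebra.Computational_Algebra"
begin

definition conj_transpose :: "complex ^ 'n ^ 'm \<Rightarrow> complex ^ 'm ^ 'n" where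
  "conj_transpose A = map_matrix cnj (transpose A)"

definition hermitian :: "complex ^ 'n ^ 'n \<Rightarrow> bool" where
  "hermitian H \<longleftrightarrow> conj_transpose H = H"

(* Neither scaleR (real scalars) nor *s (scalars of entry type, on vectors)
   multiplies a complex matrix by a complex scalar. *)
definition smult_matrix :: "complex \<Rightarrow> complex ^ 'n ^ 'm \<Rightarrow> complex ^ 'n ^ 'm" where
  "smult_matrix c A = map_matrix (\<lambda>a. c * a) A"

definition charpoly :: "complex ^ 'n ^ 'n \<Rightarrow> complex poly" where
  "charpoly A = det (mat [:0, 1:] - map_matrix (\<lambda>a. [:a:]) A)"

definition eigenvalues_mset :: "complex ^ 'n ^ 'n \<Rightarrow> complex multiset" where
  "eigenvalues_mset A = proots (charpoly A)"

(* Intended for Hermitian arguments, whose eigenvalues are all real; for other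
   matrices this counts the eigenvalues that are real and nonnegative. *)
definition num_nonneg_eigenvalues :: "complex ^ 'n ^ 'n \<Rightarrow> nat" where
  "num_nonneg_eigenvalues H =
     size (filter_mset (\<lambda>z. z \<in> \<real> \<and> Re z \<ge> 0) (eigenvalues_mset H))"

(* The scalar x^* A y. *)
definition sesq_form :: "complex ^ 'n ^ 'n \<Rightarrow> complex ^ 'n \<Rightarrow> complex ^ 'n \<Rightarrow> complex" where
  "sesq_form A x y = (\<Sum>i\<in>UNIV. cnj (x $ i) * (A *v y) $ i)"

(* vec.subspace and vec.dim refer to the scalar multiplication *s over the entry
   field, so here they are complex; the unqualified subspace and dim are real. *)
definition totally_isotropic_subspace :: "complex ^ 'n ^ 'n \<Rightarrow> (complex ^ 'n) set \<Rightarrow> bool" where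
  "totally_isotropic_subspace A V \<longleftrightarrow>
     vec.subspace V \<and> (\<forall>x\<in>V. \<forall>y\<in>V. sesq_form A x y = 0)"

lemma conj_transpose_nth [simp]: "conj_transpose A $ i $ j = cnj (A $ j $ i)"
  by (simp add: conj_transpose_def transpose_def)

lemma smult_matrix_nth [simp]: "smult_matrix c A $ i $ j = c * A $ i $ j"
  by (simp add: smult_matrix_def)

lemma hermitian_rotation:
  "hermitian (smult_matrix (exp (\<i> * of_real \<xi>)) A
     + smult_matrix (exp (- \<i> * of_real \<xi>)) (conj_transpose A))"
  by (simp add: hermitian_def vec_eq_iff exp_cnj)

end

theory Submission
  imports Defs
begin

text \<open>Write \<open>A = (H - i K) / 2\<close> with Hermitian \<open>H\<close>, \<open>K\<close>; the rotations of \<open>A\<close> are the combinations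
  \<open>cos \<xi> H + sin \<xi> K\<close>.  A totally isotropic subspace meets the span of the eigenvectors with
  negative eigenvalue trivially, which bounds its dimension by each \<open>\<nu>\<close>.

  For the converse let \<open>k\<close> be the minimum.  The rotations with \<open>cos \<xi> > 0\<close> alone already yield a
  \<open>k\<close>-dimensional \<open>K\<close>-isotropic subspace \<open>E1\<close> on which \<open>H \<ge> 0\<close>: after replacing \<open>H\<close> by
  \<open>H + \<epsilon> I\<close>, one repeatedly divides out common isotropic eigenvectors of the pencil until both forms
  become diagonal, where a bracket matching pairs basis vectors of opposite sign for \<open>K\<close>.  The other
  rotations likewise give \<open>E2\<close> with \<open>H \<le> 0\<close>.  If \<open>H\<close> is definite on \<open>E1\<close> and on \<open>E2\<close>, the pencil
  restricted to \<open>E1 + E2\<close> always has an isotropic eigenvector \<open>x\<close>, and passing to the orthogonal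
  complements of \<open>x\<close> in \<open>E1\<close> and \<open>E2\<close> produces inductively a common isotropic subspace of
  dimension \<open>k\<close>.  The semidefinite case follows by splitting off \<open>E1 \<inter> E2\<close>, which lies in the
  radical of both forms, perturbing \<open>H\<close>, and a limit of subspaces.\<close>

section \<open>Hermitian forms and subspaces\<close>

text \<open>Forms are functions instead of matrices, so that real combinations and restrictions to
  subspaces need no choice of coordinates. Conjugate-linearity in the first argument follows from
  the symmetry.\<close>

definition herm_form :: "(complex ^ 'n \<Rightarrow> complex ^ 'n \<Rightarrow> complex) \<Rightarrow> bool" where
  "herm_form F \<longleftrightarrow>
     (\<forall>x y z. F x (y + z) = F x y + F x z) \<and>
     (\<forall>c x y. F x (c *s y) = c * F x y) \<and>
     (\<forall>x y. F y x = cnj (F x y))"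

lemma herm_form_add_right: "herm_form F \<Longrightarrow> F x (y + z) = F x y + F x z"
  and herm_form_scale_right: "herm_form F \<Longrightarrow> F x (c *s y) = c * F x y"
  and herm_form_cnj: "herm_form F \<Longrightarrow> cnj (F x y) = F y x"
  unfolding herm_form_def by metis+

lemma herm_form_add_left: "herm_form F \<Longrightarrow> F (x + y) z = F x z + F y z"
proof -
  assume F: "herm_form F"
  show ?thesis
    using arg_cong[OF herm_form_add_right[OF F, of z x y], of cnj]
    by (simp only: complex_cnj_add herm_form_cnj[OF F])
qed

lemma herm_form_scale_left: "herm_form F \<Longrightarrow> F (c *s x) y = cnj c * F x y"
proof -
  assume F: "herm_form F"
  show ?thesis
    using arg_cong[OF herm_form_scale_right[OF F, of y c x], of cnj]
    by (simp only: complex_cnj_mult herm_form_cnj[OF F])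
qed

lemma herm_form_zero_right: "herm_form F \<Longrightarrow> F x 0 = 0"
  using herm_form_scale_right[of F x 0 0] by simp

lemma herm_form_zero_left: "herm_form F \<Longrightarrow> F 0 x = 0"
  using herm_form_scale_left[of F 0 0 x] by simp

lemmas herm_form_simps =
  herm_form_add_right herm_form_scale_right herm_form_add_left herm_form_scale_left
  herm_form_zero_left herm_form_zero_right

lemma herm_form_sum_right:
  assumes "herm_form F"
  shows "F x (\<Sum>i\<in>S. f i) = (\<Sum>i\<in>S. F x (f i))"
  by (induction S rule: infinite_finite_induct) (simp_all add: herm_form_simps[OF assms])

lemma herm_form_eq_0_commute: "herm_form F \<Longrightarrow> F x y = 0 \<longleftrightarrow> F y x = 0"
  using herm_form_cnj[of F x y] herm_form_cnj[of F y x] by auto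

lemma herm_form_Im_diag: "herm_form F \<Longrightarrow> Im (F x x) = 0"
  using arg_cong[OF herm_form_cnj[of F x x], of Im] by simp

lemma herm_form_diag_real: "herm_form F \<Longrightarrow> F x x = complex_of_real (Re (F x x))"
  using herm_form_Im_diag[of F x] by (simp add: complex_eq_iff)

lemma herm_form_diag_eq_0: "herm_form F \<Longrightarrow> F x x = 0 \<longleftrightarrow> Re (F x x) = 0"
  using herm_form_Im_diag[of F x] by (simp add: complex_eq_iff)

lemma herm_form_real_combination:
  assumes "herm_form F" "herm_form G"
  shows "herm_form (\<lambda>x y. complex_of_real a * F x y + complex_of_real b * G x y)"
  unfolding herm_form_def
  by (auto simp: algebra_simps herm_form_simps[OF assms(1)] herm_form_simps[OF assms(2)]
      herm_form_cnj[OF assms(1)] herm_form_cnj[OF assms(2)])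

lemma herm_form_uminus: "herm_form F \<Longrightarrow> herm_form (\<lambda>x y. - F x y)"
  using herm_form_real_combination[of F F "-1" 0] by simp

lemma herm_form_add_real:
  "herm_form F \<Longrightarrow> herm_form G \<Longrightarrow> herm_form (\<lambda>x y. F x y + complex_of_real b * G x y)"
  using herm_form_real_combination[of F G 1 b] by simp

lemma subspace_herm_form_kernel_right:
  assumes "herm_form F" "vec.subspace W"
  shows "vec.subspace {y \<in> W. F x y = 0}"
  using assms(2) by (auto simp: vec.subspace_def herm_form_simps[OF assms(1)])

lemma herm_form_eq_0_span_left:
  assumes "herm_form F" "\<And>b. b \<in> B \<Longrightarrow> F b z = 0" "y \<in> vec.span B"
  shows "F y z = 0"
  using assms(3)
  by (induction rule: vec.span_induct_alt) (use assms(2) in \<open>auto simp: herm_form_simps[OF assms(1)]\<close>)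

lemma herm_form_eq_0_span_right:
  assumes "herm_form F" "\<And>b. b \<in> B \<Longrightarrow> F z b = 0" "y \<in> vec.span B"
  shows "F z y = 0"
  using herm_form_eq_0_span_left[of F B z y] assms herm_form_eq_0_commute by blast

section \<open>The standard inner product and dimension counts\<close>

definition cinner :: "complex ^ 'n \<Rightarrow> complex ^ 'n \<Rightarrow> complex" where
  "cinner x y = (\<Sum>i\<in>UNIV. cnj (x $ i) * y $ i)"

lemma herm_form_cinner: "herm_form cinner"
  unfolding herm_form_def cinner_def
  by (auto simp: algebra_simps sum.distrib sum_distrib_left)

lemma Re_cinner_self: "Re (cinner x x) = (norm x)\<^sup>2"
proof -
  have "Re (cinner x x) = (\<Sum>i\<in>UNIV. (norm (x $ i))\<^sup>2)"
    unfolding cinner_def by (simp add: cmod_def power2_eq_square)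
  then show ?thesis
    by (simp add: norm_vec_def L2_set_def sum_nonneg)
qed

lemma cinner_self_eq_0 [simp]: "cinner x x = 0 \<longleftrightarrow> x = 0"
  using herm_form_diag_eq_0[OF herm_form_cinner, of x] by (simp add: Re_cinner_self)

text \<open>If \<open>F x w\<close> is nonzero for some \<open>w\<close> in \<open>W\<close>,
  subtracting a multiple of \<open>w\<close> moves any vector of \<open>W\<close> into the kernel,
  so one linear condition costs at most one dimension.\<close>

lemma dim_kernel:
  assumes W: "vec.subspace (W :: (complex ^ 'n) set)" and F: "herm_form F"
  shows "vec.dim W \<le> vec.dim {y \<in> W. F x y = 0} + 1"
proof (cases "\<forall>y\<in>W. F x y = 0")
  case True
  then have "{y \<in> W. F x y = 0} = W" by auto
  then show ?thesis by simp
next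
  case False
  then obtain w where w: "w \<in> W" "F x w \<noteq> 0" by auto
  let ?K = "{y \<in> W. F x y = 0}"
  have "W \<subseteq> vec.span (insert w ?K)"
  proof
    fix y assume y: "y \<in> W"
    have "y - (F x y / F x w) *s w \<in> ?K"
    proof -
      have "y - (F x y / F x w) *s w \<in> W"
        using W y w by (simp add: vec.subspace_diff vec.subspace_scale)
      moreover have "F x (y - (F x y / F x w) *s w) = 0"
        using herm_form_add_right[OF F, of x "y - (F x y / F x w) *s w" "(F x y / F x w) *s w"] w
        by (simp add: herm_form_scale_right[OF F])
      ultimately show ?thesis by simp
    qed
    then show "y \<in> vec.span (insert w ?K)"
      unfolding vec.span_breakdown_eq by (auto intro: vec.span_base)
  qed
  then have "vec.dim W \<le> vec.dim (insert w ?K)"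
    using vec.dim_mono by blast
  also have "\<dots> \<le> vec.dim ?K + 1"
    by (simp add: vec.dim_insert)
  finally show ?thesis .
qed

lemma dim_kernel_finite:
  assumes W: "vec.subspace (W :: (complex ^ 'n) set)" and F: "herm_form F" and S: "finite S"
  shows "vec.dim W \<le> vec.dim {y \<in> W. \<forall>s\<in>S. F s y = 0} + card S"
  using S
proof (induction S)
  case empty
  then show ?case by simp
next
  case (insert s S)
  let ?K = "{y \<in> W. \<forall>s\<in>S. F s y = 0}"
  have "vec.subspace ?K"
    using W by (auto simp: vec.subspace_def herm_form_simps[OF F])
  from dim_kernel[OF this F, of s]
  have "vec.dim ?K \<le> vec.dim {y \<in> ?K. F s y = 0} + 1" .
  moreover have "{y \<in> ?K. F s y = 0} = {y \<in> W. \<forall>s\<in>insert s S. F s y = 0}" by auto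
  ultimately show ?case using insert by simp
qed

lemma exists_nonzero_of_dim_pos:
  assumes "0 < vec.dim (W :: (complex ^ 'n) set)"
  obtains x where "x \<in> W" "x \<noteq> 0"
proof -
  have "\<not> W \<subseteq> {0}" using assms vec.dim_eq_0[of W] by linarith
  then show ?thesis using that by blast
qed

lemma exists_subspace_of_dim:
  assumes "vec.subspace (W :: (complex ^ 'n) set)" "k \<le> vec.dim W"
  obtains V where "vec.subspace V" "V \<subseteq> W" "vec.dim V = k"
  using vec.choose_subspace_of_subspace[OF assms(2)] assms(1)
  by (metis vec.span_eq_iff)

lemma dim_Int_ge:
  assumes "vec.subspace (S :: (complex ^ 'n) set)" "vec.subspace T" "vec.subspace W"
    "S \<subseteq> W" "T \<subseteq> W"
  shows "vec.dim S + vec.dim T \<le> vec.dim W + vec.dim (S \<inter> T)"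
proof -
  have "{x + y |x y. x \<in> S \<and> y \<in> T} \<subseteq> W"
    using assms by (auto intro: vec.subspace_add)
  then have "vec.dim {x + y |x y. x \<in> S \<and> y \<in> T} \<le> vec.dim W"
    by (rule vec.dim_subset)
  then show ?thesis
    using vec.dim_sums_Int[OF assms(1,2)] by linarith
qed

lemma dim_span_insert:
  assumes "vec.subspace (V :: (complex ^ 'n) set)" "x \<notin> V"
  shows "vec.dim (vec.span (insert x V)) = vec.dim V + 1"
  by (simp add: vec.dim_insert assms(2) vec.span_eq_iff[THEN iffD2, OF assms(1)])

lemma span_insert_subspace:
  assumes "vec.subspace (V :: (complex ^ 'n) set)" "y \<in> vec.span (insert x V)"
  obtains c v where "v \<in> V" "y = c *s x + v"
proof -
  obtain c where "y - c *s x \<in> V"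
    using assms(2) unfolding vec.span_breakdown_eq vec.span_eq_iff[THEN iffD2, OF assms(1)] by blast
  then show ?thesis using that[of "y - c *s x" c] by simp
qed

lemma herm_form_vanishes_on_span_insert:
  assumes F: "herm_form F" and V: "vec.subspace V"
    and "\<And>v w. v \<in> V \<Longrightarrow> w \<in> V \<Longrightarrow> F v w = 0" "\<And>v. v \<in> V \<Longrightarrow> F x v = 0" "F x x = 0"
    and yz: "y \<in> vec.span (insert x V)" "z \<in> vec.span (insert x V)"
  shows "F y z = 0"
proof -
  obtain c v where v: "v \<in> V" "y = c *s x + v" using span_insert_subspace[OF V yz(1)] .
  obtain d w where w: "w \<in> V" "z = d *s x + w" using span_insert_subspace[OF V yz(2)] .
  have "F v x = 0" using assms(4)[OF v(1)] herm_form_eq_0_commute[OF F] by blast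
  then show ?thesis using v w assms(3-5) by (simp add: herm_form_simps[OF F])
qed

text \<open>Since \<open>x\<close> is orthogonal to \<open>V\<close>, the form at
  \<open>c *s x + v\<close> is \<open>|c|^2 F x x + F v v\<close>, without cross terms.\<close>

lemma herm_form_nonneg_on_span_insert:
  assumes F: "herm_form F" and V: "vec.subspace V"
    and "\<And>v. v \<in> V \<Longrightarrow> 0 \<le> Re (F v v)" "\<And>v. v \<in> V \<Longrightarrow> F x v = 0" "0 \<le> Re (F x x)"
    and y: "y \<in> vec.span (insert x V)"
  shows "0 \<le> Re (F y y)"
proof -
  obtain c v where v: "v \<in> V" "y = c *s x + v" using span_insert_subspace[OF V y] .
  have "F v x = 0" using assms(4)[OF v(1)] herm_form_eq_0_commute[OF F] by blast
  then have "F y y = (cnj c * c) * F x x + F v v" using v assms(4) by (simp add: herm_form_simps[OF F])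
  also have "Re \<dots> = (cmod c)\<^sup>2 * Re (F x x) + Re (F v v)"
    unfolding cmod_power2 by (simp add: herm_form_Im_diag[OF F] power2_eq_square)
  finally show ?thesis using v assms(3,5) by simp
qed

section \<open>Eigenvectors of a pencil of Hermitian forms\<close>

text \<open>Stated for families, because the iterates of an operator may repeat. A repetition is
  itself a relation, with coefficients 1 and -1; otherwise linear dependence of the image set
  applies.\<close>

lemma nontrivial_relation:
  fixes f :: "nat \<Rightarrow> complex ^ 'n"
  assumes "\<And>i. f i \<in> W" "vec.dim W \<le> N"
  shows "\<exists>c. (\<exists>i\<le>N. c i \<noteq> 0) \<and> (\<Sum>i\<le>N. c i *s f i) = 0"
proof (cases "inj_on f {..N}")
  case True
  have "vec.dependent (f ` {..N})"
  proof (rule ccontr)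
    assume "\<not> ?thesis"
    moreover have "f ` {..N} \<subseteq> W" using assms by auto
    ultimately have "card (f ` {..N}) \<le> vec.dim W"
      using vec.independent_card_le_dim by blast
    then show False using assms by (simp add: card_image[OF True])
  qed
  then obtain u where u: "\<exists>v\<in>f ` {..N}. u v \<noteq> 0" "(\<Sum>v\<in>f ` {..N}. u v *s v) = 0"
    using vec.dependent_finite[of "f ` {..N}"] by auto
  have "(\<Sum>i\<le>N. u (f i) *s f i) = 0"
    using u(2) sum.reindex[OF True, of "\<lambda>v. u v *s v"] by (simp add: o_def)
  then show ?thesis using u(1) by (intro exI[of _ "u \<circ> f"]) auto
next
  case False
  then obtain i j where ij: "i \<le> N" "j \<le> N" "i \<noteq> j" "f i = f j" by (auto simp: inj_on_def)
  let ?c = "\<lambda>k. if k = i then 1 else if k = j then -1 else (0::complex)"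
  have "(\<Sum>k\<le>N. ?c k *s f k) = (\<Sum>k\<in>{i, j}. ?c k *s f k)"
    using ij by (intro sum.mono_neutral_right) auto
  also have "\<dots> = 0" using ij by simp
  finally show ?thesis using ij by (intro exI[of _ ?c]) auto
qed

text \<open>For \<open>K\<close> nondegenerate on \<open>W\<close> this is the vector
  \<open>K^(-1) H x\<close>, from which the operator of the pencil is built. It is assembled from a
  basis \<open>\<zeta>\<close> that is \<open>K\<close>-dual to a basis \<open>B\<close> of
  \<open>W\<close>.\<close>

lemma herm_form_represent:
  fixes H K :: "complex ^ 'n \<Rightarrow> complex ^ 'n \<Rightarrow> complex"
  assumes H: "herm_form H" and K: "herm_form K" and W: "vec.subspace W"
    and nondeg: "\<And>x. x \<in> W \<Longrightarrow> x \<noteq> 0 \<Longrightarrow> \<exists>y\<in>W. K y x \<noteq> 0"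
  shows "\<exists>z\<in>W. \<forall>y\<in>W. K y z = H y x"
proof -
  obtain B where B: "finite B" "B \<subseteq> W" "vec.span B = W" "card B = vec.dim W"
    using vec.basis_subspace_exists[OF W] by metis
  have "\<exists>z\<in>W. \<forall>c\<in>B. K c z = (if c = b then 1 else 0)" if b: "b \<in> B" for b
  proof -
    \<comment> \<open>Being \<open>K\<close>-orthogonal to the other basis vectors is one condition
      fewer than \<open>vec.dim W\<close>, so a nonzero \<open>z\<close> survives. By nondegeneracy
      it cannot be orthogonal to \<open>b\<close> as well, and can be rescaled.\<close>
    have "vec.dim W \<le> vec.dim {z \<in> W. \<forall>c\<in>B - {b}. K c z = 0} + card (B - {b})"
      using dim_kernel_finite[OF W K] B by blast
    moreover have "card (B - {b}) < vec.dim W"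
      using B b card_Diff1_less by metis
    ultimately have "0 < vec.dim {z \<in> W. \<forall>c\<in>B - {b}. K c z = 0}" by linarith
    then obtain z where "z \<in> {z \<in> W. \<forall>c\<in>B - {b}. K c z = 0}" "z \<noteq> 0"
      by (rule exists_nonzero_of_dim_pos)
    then have z: "z \<in> W" "\<And>c. c \<in> B - {b} \<Longrightarrow> K c z = 0" "z \<noteq> 0"
      by auto
    have "K b z \<noteq> 0"
    proof
      assume "K b z = 0"
      then have "K y z = 0" if "y \<in> W" for y
        using herm_form_eq_0_span_left[OF K, of B z y] z(2) that B(3) \<open>K b z = 0\<close> by fast
      then show False using nondeg z by blast
    qed
    then show ?thesis
      using z W by (intro bexI[of _ "(1 / K b z) *s z"])
        (auto simp: herm_form_simps[OF K] vec.subspace_scale)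
  qed
  then obtain \<zeta> where \<zeta>: "\<And>b. b \<in> B \<Longrightarrow> \<zeta> b \<in> W"
    "\<And>b c. b \<in> B \<Longrightarrow> c \<in> B \<Longrightarrow> K c (\<zeta> b) = (if c = b then 1 else 0)"
    by metis
  let ?z = "\<Sum>b\<in>B. H b x *s \<zeta> b"
  have z: "?z \<in> W" using \<zeta> W by (auto intro!: vec.subspace_sum vec.subspace_scale)
  have "K y ?z = H y x" if "y \<in> W" for y
  proof -
    have "y \<in> vec.span B" using that B by simp
    then show ?thesis
    proof (induction rule: vec.span_induct_alt)
      case base
      then show ?case by (simp add: herm_form_zero_left[OF H] herm_form_zero_left[OF K])
    next
      case (step c b y)
      have "K b ?z = (\<Sum>a\<in>B. H a x * K b (\<zeta> a))"
        by (simp add: herm_form_sum_right[OF K] herm_form_simps[OF K])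
      also have "\<dots> = (\<Sum>a\<in>B. if b = a then H a x else 0)"
        using step(1) \<zeta>(2) by (intro sum.cong) simp_all
      also have "\<dots> = H b x"
        using step(1) B(1) by simp
      finally have "K b ?z = H b x" .
      then show ?case
        using step by (simp add: herm_form_simps[OF K] herm_form_simps[OF H])
    qed
  qed
  then show ?thesis using z by blast
qed

text \<open>If \<open>K\<close> has no radical in \<open>W\<close>, an operator \<open>T\<close>
  satisfies \<open>K y (T x) = H y x\<close>, and its eigenvectors are those of the pencil. One is
  found from a polynomial of least degree annihilating an orbit of \<open>T\<close>, by splitting
  off a linear factor.\<close>

lemma pencil_eigenvector:
  fixes H K :: "complex ^ 'n \<Rightarrow> complex ^ 'n \<Rightarrow> complex"
  assumes H: "herm_form H" and K: "herm_form K" and W: "vec.subspace W" "0 < vec.dim W"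
  shows "\<exists>x\<in>W. x \<noteq> 0 \<and>
    ((\<forall>y\<in>W. K y x = 0) \<or> (\<exists>\<mu>. \<forall>y\<in>W. H y x = \<mu> * K y x))"
proof (cases "\<exists>x\<in>W. x \<noteq> 0 \<and> (\<forall>y\<in>W. K y x = 0)")
  case True
  then show ?thesis by blast
next
  case False
  have "\<exists>z\<in>W. \<forall>y\<in>W. K y z = H y x" for x
    using herm_form_represent[OF H K W(1)] False by blast
  then obtain T where T: "\<And>x. T x \<in> W" "\<And>x y. y \<in> W \<Longrightarrow> K y (T x) = H y x" by metis
  obtain v0 where v0: "v0 \<in> W" "v0 \<noteq> 0" by (rule exists_nonzero_of_dim_pos[OF W(2)])
  define v where "v = (\<lambda>i. (T ^^ i) v0)"
  define N where "N = vec.dim W"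
  \<comment> \<open>\<open>ev q\<close> stands for \<open>q(T) v0\<close>. Linearity of
    \<open>T\<close> is never established; only the relation between consecutive \<open>v i\<close>
    is used. Summing up to \<open>Suc N\<close> leaves room for multiplying by the variable
    once.\<close>
  define ev where "ev = (\<lambda>q. \<Sum>i\<le>Suc N. coeff q i *s v i)"
  have vW: "v i \<in> W" for i using v0 T by (cases i) (auto simp: v_def)
  have Hv: "H y (v i) = K y (v (Suc i))" if "y \<in> W" for y i
    using T that by (simp add: v_def)
  have ev_diff: "ev (p - q) = ev p - ev q" for p q
    by (simp add: ev_def sum_subtractf vec.scale_left_diff_distrib)
  have ev_smult: "ev (smult c p) = c *s ev p" for c p
    by (simp add: ev_def vec.scale_sum_right del: sum.atMost_Suc)
  let ?P = "\<lambda>q. q \<noteq> 0 \<and> degree q \<le> N \<and> ev q = 0"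
  have "\<exists>q. ?P q"
  proof -
    obtain c where c: "\<exists>i\<le>N. c i \<noteq> 0" "(\<Sum>i\<le>N. c i *s v i) = 0"
      using nontrivial_relation[of v W N] vW by (auto simp: N_def)
    define q where "q = (\<Sum>i\<le>N. monom (c i) i)"
    have co: "coeff q i = (if i \<le> N then c i else 0)" for i
      by (simp add: q_def coeff_sum)
    have "q \<noteq> 0" using c co by (metis coeff_0)
    moreover have "degree q \<le> N" by (rule degree_le) (simp add: co)
    moreover have "ev q = 0" using c by (simp add: ev_def co)
    ultimately show ?thesis by blast
  qed
  then obtain q where q: "?P q" "\<And>p. ?P p \<Longrightarrow> degree q \<le> degree p"
    using ex_has_least_nat[of ?P _ degree] by blast
  have "degree q \<noteq> 0"
  proof
    assume "degree q = 0"
    then obtain a where a: "q = [:a:]" using degree_eq_zeroE by blast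
    have "ev q = a *s v 0"
      unfolding ev_def a by (subst sum.atMost_Suc_shift) simp
    then show False using q a v0 by (auto simp: v_def)
  qed
  then obtain \<mu> where "poly q \<mu> = 0"
    using fundamental_theorem_of_algebra[of q] by (auto simp: constant_degree)
  then obtain r where r: "q = [:-\<mu>, 1:] * r" by (auto simp: poly_eq_0_iff_dvd dvd_def)
  then have r0: "r \<noteq> 0" using q by auto
  have dr: "degree q = Suc (degree r)" using r0 unfolding r by (simp add: degree_mult_eq del: mult_pCons_left)
  define x where "x = ev r"
  \<comment> \<open>The cofactor \<open>r\<close> has smaller degree than \<open>q\<close>, so by
    minimality it does not annihilate \<open>v0\<close>.\<close>
  have x0: "x \<noteq> 0" using q(2)[of r] q(1) r0 dr by (auto simp: x_def)
  have xW: "x \<in> W" unfolding x_def ev_def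
    using W vW by (auto intro!: vec.subspace_sum vec.subspace_scale vec.subspace_add)
  have shift: "ev (pCons 0 r) = (\<Sum>i\<le>Suc N. coeff r i *s v (Suc i))"
  proof -
    have "coeff r (Suc N) = 0" using dr q(1) by (intro coeff_eq_0) simp
    then show ?thesis unfolding ev_def
      by (subst sum.atMost_Suc_shift) simp
  qed
  \<comment> \<open>This is \<open>(T - \<mu>) r(T) v0 = q(T) v0 = 0\<close>, the eigenvector
    equation for \<open>x\<close>.\<close>
  have "pCons 0 r - smult (\<mu>) r = q" by (simp add: r)
  then have "ev (pCons 0 r) - \<mu> *s x = 0"
    using q(1) by (metis ev_diff ev_smult x_def)
  then have ev2: "ev (pCons 0 r) = \<mu> *s x" by simp
  have "H y x = \<mu> * K y x" if "y \<in> W" for y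
  proof -
    have "H y x = (\<Sum>i\<le>Suc N. coeff r i * H y (v i))"
      unfolding x_def ev_def herm_form_sum_right[OF H] herm_form_scale_right[OF H] ..
    also have "\<dots> = (\<Sum>i\<le>Suc N. coeff r i * K y (v (Suc i)))"
      using Hv[OF that] by simp
    also have "\<dots> = K y (\<Sum>i\<le>Suc N. coeff r i *s v (Suc i))"
      unfolding herm_form_sum_right[OF K] herm_form_scale_right[OF K] ..
    also have "\<dots> = \<mu> * K y x"
      unfolding shift[symmetric] ev2 herm_form_scale_right[OF K] ..
    finally show ?thesis .
  qed
  then show ?thesis using x0 xW by blast
qed

text \<open>The first alternative is the eigenvalue infinity, which occurs when \<open>K\<close> is
  degenerate on \<open>W\<close>. The equations are tested only against \<open>W\<close>.\<close>

definition pencil_eigen where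
  "pencil_eigen H K W x \<longleftrightarrow>
     (\<forall>y\<in>W. K y x = (0::complex)) \<or> (\<exists>\<mu>. \<forall>y\<in>W. H y x = \<mu> * K y x)"

lemma subspace_pencil_kernel:
  assumes "herm_form H" "herm_form K" "vec.subspace W"
  shows "vec.subspace {y \<in> W. H x y = 0 \<and> K x y = 0}"
  using assms(3)
  by (auto simp: vec.subspace_def herm_form_simps[OF assms(1)] herm_form_simps[OF assms(2)])

text \<open>For an eigenvector, one of the two orthogonality conditions implies the other or holds
  trivially, so together they cost one dimension instead of two. Every induction on a dimension
  below rests on this.\<close>

lemma dim_pencil_kernel:
  fixes H K :: "complex ^ 'n \<Rightarrow> complex ^ 'n \<Rightarrow> complex"
  assumes H: "herm_form H" and K: "herm_form K"
    and E: "vec.subspace E" "E \<subseteq> W" and x: "pencil_eigen H K W x"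
  shows "vec.dim E \<le> vec.dim {y \<in> E. H x y = 0 \<and> K x y = 0} + 1"
  using x unfolding pencil_eigen_def
proof
  assume "\<forall>y\<in>W. K y x = 0"
  then have "K x y = 0" if "y \<in> E" for y
    using that E herm_form_eq_0_commute[OF K] by blast
  then have "{y \<in> E. H x y = 0 \<and> K x y = 0} = {y \<in> E. H x y = 0}" by blast
  then show ?thesis using dim_kernel[OF E(1) H] by simp
next
  assume "\<exists>\<mu>. \<forall>y\<in>W. H y x = \<mu> * K y x"
  then obtain \<mu> where "\<And>y. y \<in> W \<Longrightarrow> H y x = \<mu> * K y x" by blast
  then have "H x y = 0" if "y \<in> E" "K x y = 0" for y
    using that E herm_form_eq_0_commute[OF K, of x y] herm_form_eq_0_commute[OF H, of x y]
    by (metis mult_zero_right subsetD)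
  then have "{y \<in> E. H x y = 0 \<and> K x y = 0} = {y \<in> E. K x y = 0}" by blast
  then show ?thesis using dim_kernel[OF E(1) K] by simp
qed

lemma dim_less_of_proper_subspace:
  assumes "vec.subspace (S :: (complex ^ 'n) set)" "vec.subspace T" "S \<subseteq> T" "x \<in> T" "x \<notin> S"
  shows "vec.dim S < vec.dim T"
  using vec.subspace_dim_equal[OF assms(1-3)] assms(4,5) by force

section \<open>Simultaneous diagonalisation of two forms\<close>

definition orth_basis where
  "orth_basis H K W B \<longleftrightarrow> finite B \<and> vec.independent B \<and> vec.span B = W \<and>
     (\<forall>a\<in>B. \<forall>b\<in>B. a \<noteq> b \<longrightarrow> H a b = 0 \<and> K a b = (0::complex))"

text \<open>Successively splitting off an eigenvector on which one of the two forms does not vanish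
  diagonalises both forms simultaneously, unless one meets a common isotropic eigenvector.\<close>

lemma isotropic_eigenvector_or_orth_basis:
  fixes H K :: "complex ^ 'n \<Rightarrow> complex ^ 'n \<Rightarrow> complex"
  assumes H: "herm_form H" and K: "herm_form K" and "vec.subspace W"
  shows "(\<exists>x\<in>W. x \<noteq> 0 \<and> H x x = 0 \<and> K x x = 0 \<and> pencil_eigen H K W x) \<or>
    (\<exists>B. orth_basis H K W B)"
  using assms(3)
proof (induction "vec.dim W" arbitrary: W rule: less_induct)
  case less
  show ?case
  proof (cases "vec.dim W = 0")
    case True
    then have "W = {0}" using less.prems vec.subspace_0 by fastforce
    then have "orth_basis H K W {}" by (simp add: orth_basis_def vec.independent_empty)
    then show ?thesis by blast
  next
    case False
    then obtain x where x: "x \<in> W" "x \<noteq> 0" "pencil_eigen H K W x"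
      using pencil_eigenvector[OF H K less.prems] unfolding pencil_eigen_def by blast
    show ?thesis
    proof (cases "H x x = 0 \<and> K x x = 0")
      case True
      then show ?thesis using x by blast
    next
      case nz: False
      \<comment> \<open>As one of the forms is nonzero at \<open>x\<close>, the common orthogonal
        complement \<open>U\<close> misses \<open>x\<close>; by the dimension count it has
        codimension exactly one in \<open>W\<close>.\<close>
      define U where "U = {y \<in> W. H x y = 0 \<and> K x y = 0}"
      have U: "vec.subspace U"
        unfolding U_def by (rule subspace_pencil_kernel[OF H K less.prems])
      have xU: "x \<notin> U" using nz unfolding U_def by blast
      have UW: "U \<subseteq> W" and Ux: "\<And>y. y \<in> U \<Longrightarrow> H x y = 0 \<and> K x y = 0"
        unfolding U_def by blast+
      have dU: "vec.dim U < vec.dim W"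
        by (rule dim_less_of_proper_subspace[OF U less.prems UW x(1) xU])
      have spanW: "vec.span (insert x U) = W"
      proof (rule vec.subspace_dim_equal)
        show "vec.span (insert x U) \<subseteq> W"
          using x UW less.prems by (intro vec.span_minimal) auto
        show "vec.dim W \<le> vec.dim (vec.span (insert x U))"
          using dim_span_insert[OF U xU] dim_pencil_kernel[OF H K less.prems _ x(3)] by (simp add: U_def)
      qed (use less.prems in auto)
      consider (iso) z where "z \<in> U" "z \<noteq> 0" "H z z = 0" "K z z = 0" "pencil_eigen H K U z"
        | (basis) B where "orth_basis H K U B"
        using less.hyps[OF dU U] by (elim disjE bexE exE conjE)
      then show ?thesis
      proof cases
        case iso
        \<comment> \<open>The \<open>x\<close>-component of \<open>y\<close> is orthogonal to
          \<open>z\<close> for both forms, so eigenvector equations that hold against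
          \<open>U\<close> extend to all of \<open>W\<close>.\<close>
        have *: "\<exists>w\<in>U. H y z = H w z \<and> K y z = K w z" if y: "y \<in> W" for y
        proof -
          obtain c w where "w \<in> U" "y = c *s x + w"
            using span_insert_subspace[OF U] spanW y by metis
          then show ?thesis using iso(1)
            Ux[OF iso(1)]
            by (intro bexI[of _ w]) (simp_all add: herm_form_simps[OF H] herm_form_simps[OF K])
        qed
        have "pencil_eigen H K W z"
          using iso(5) unfolding pencil_eigen_def
        proof
          assume a: "\<forall>y\<in>U. K y z = 0"
          have "K y z = 0" if "y \<in> W" for y using *[OF that] a by fastforce
          then show "(\<forall>y\<in>W. K y z = 0) \<or> (\<exists>\<mu>. \<forall>y\<in>W. H y z = \<mu> * K y z)" by blast
        next
          assume "\<exists>\<mu>. \<forall>y\<in>U. H y z = \<mu> * K y z"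
          then obtain \<mu> where a: "\<forall>y\<in>U. H y z = \<mu> * K y z" by blast
          have "H y z = \<mu> * K y z" if "y \<in> W" for y using *[OF that] a by fastforce
          then show "(\<forall>y\<in>W. K y z = 0) \<or> (\<exists>\<mu>. \<forall>y\<in>W. H y z = \<mu> * K y z)" by blast
        qed
        then show ?thesis using iso(1-4) UW by (intro disjI1 bexI[of _ z]) auto
      next
        case basis
        then have B: "finite B" "vec.independent B" "vec.span B = U"
          "\<And>a b. a \<in> B \<Longrightarrow> b \<in> B \<Longrightarrow> a \<noteq> b \<Longrightarrow> H a b = 0 \<and> K a b = 0"
          unfolding orth_basis_def by blast+
        have BU: "B \<subseteq> U" using B(3) vec.span_superset by metis
        have "vec.independent (insert x B)"
          using xU B by (intro vec.independent_insertI) simp_all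
        moreover have "vec.span (insert x B) = W"
        proof (rule subset_antisym)
          show "vec.span (insert x B) \<subseteq> W"
            using x BU UW less.prems by (intro vec.span_minimal) auto
          have "U \<subseteq> vec.span (insert x B)" using B(3) vec.span_mono[of B "insert x B"] by blast
          then have "insert x U \<subseteq> vec.span (insert x B)" by (auto intro: vec.span_base)
          then have "vec.span (insert x U) \<subseteq> vec.span (insert x B)"
            by (rule vec.span_minimal) simp
          then show "W \<subseteq> vec.span (insert x B)" unfolding spanW .
        qed
        moreover have "H a b = 0 \<and> K a b = 0"
          if "a \<in> insert x B" "b \<in> insert x B" "a \<noteq> b" for a b
          using that B(4)[of a b] BU Ux[of a] Ux[of b]
            herm_form_eq_0_commute[OF H, of x a] herm_form_eq_0_commute[OF K, of x a] by auto
        ultimately have "orth_basis H K W (insert x B)"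
          using B(1) unfolding orth_basis_def by blast
        then show ?thesis by blast
      qed
    qed
  qed
qed

section \<open>Positivity on subspaces\<close>

text \<open>The positive index of inertia of \<open>F\<close> on \<open>W\<close> is at least
  \<open>k\<close>. Only such lower bounds are needed, so the index itself is not defined.\<close>

definition positive_dim_ge where
  "positive_dim_ge F W k \<longleftrightarrow> (\<exists>P. vec.subspace P \<and> P \<subseteq> W \<and> k \<le> vec.dim P \<and>
     (\<forall>x\<in>P. x \<noteq> 0 \<longrightarrow> 0 < Re (F x x)))"

text \<open>Passing from \<open>W\<close> to \<open>U / span x\<close>, where \<open>x\<close> spans
  part of the radical of \<open>F\<close> on \<open>U\<close>, costs at most one positive dimension.
  The quotient is modelled by the orthogonal complement of \<open>x\<close> in
  \<open>U\<close>.\<close>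

lemma positive_dim_ge_quotient:
  fixes F :: "complex ^ 'n \<Rightarrow> complex ^ 'n \<Rightarrow> complex"
  assumes F: "herm_form F" and U: "vec.subspace U" "U \<subseteq> W"
    and x: "x \<in> U" "F x x = 0" "\<And>y. y \<in> U \<Longrightarrow> F x y = 0" "x \<noteq> 0"
    and codim: "\<And>P. vec.subspace P \<Longrightarrow> P \<subseteq> W \<Longrightarrow> vec.dim P \<le> vec.dim (P \<inter> U) + 1"
    and pos: "positive_dim_ge F W (Suc k)"
  shows "positive_dim_ge F {y \<in> U. cinner x y = 0} k"
proof -
  obtain P where P: "vec.subspace P" "P \<subseteq> W" "Suc k \<le> vec.dim P"
    "\<And>y. y \<in> P \<Longrightarrow> y \<noteq> 0 \<Longrightarrow> 0 < Re (F y y)"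
    using pos unfolding positive_dim_ge_def by blast
  have P1: "vec.subspace (P \<inter> U)" using P U by (simp add: vec.subspace_inter)
  have "x \<notin> P \<inter> U" using P(4)[of x] x by auto
  then have d: "vec.dim (vec.span (insert x (P \<inter> U))) = vec.dim (P \<inter> U) + 1"
    by (rule dim_span_insert[OF P1])
  \<comment> \<open>Adjoining \<open>x\<close> and then cutting with its orthogonal complement
    projects \<open>P \<inter> U\<close> along \<open>x\<close>. The dimension does not drop, and
    values of \<open>F\<close> are unchanged because \<open>x\<close> lies in the radical on
    \<open>U\<close>.\<close>
  let ?Q = "{y \<in> vec.span (insert x (P \<inter> U)). cinner x y = 0}"
  have "vec.subspace ?Q" by (intro subspace_herm_form_kernel_right herm_form_cinner) simp
  moreover have "k \<le> vec.dim ?Q"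
    using dim_kernel[OF _ herm_form_cinner, of "vec.span (insert x (P \<inter> U))" x] d
      codim[OF P(1,2)] P(3) by simp
  moreover have "vec.span (insert x (P \<inter> U)) \<subseteq> U"
    using x U by (intro vec.span_minimal) auto
  moreover have "0 < Re (F y y)" if "y \<in> ?Q" "y \<noteq> 0" for y
  proof -
    have "y \<in> vec.span (insert x (P \<inter> U))" using that(1) by blast
    then obtain c p where p: "p \<in> P \<inter> U" "y = c *s x + p"
      by (rule span_insert_subspace[OF P1])
    have "F x p = 0" using x(3) p(1) by blast
    moreover then have "F p x = 0" using herm_form_eq_0_commute[OF F] by blast
    ultimately have "F y y = F p p" using p(2) x(2) by (simp add: herm_form_simps[OF F])
    moreover have "p \<noteq> 0"
    proof
      assume "p = 0"
      then have "c * cinner x x = 0"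
        using that p by (simp add: herm_form_simps[OF herm_form_cinner])
      then show False using that p x \<open>p = 0\<close> by simp
    qed
    ultimately show ?thesis using P(4) p by simp
  qed
  ultimately show ?thesis unfolding positive_dim_ge_def by blast
qed

lemma herm_form_diagonal:
  fixes F :: "complex ^ 'n \<Rightarrow> complex ^ 'n \<Rightarrow> complex"
  assumes F: "herm_form F" and B: "finite B"
    and orth: "\<And>a b. a \<in> B \<Longrightarrow> b \<in> B \<Longrightarrow> a \<noteq> b \<Longrightarrow> F a b = 0"
  shows "Re (F (\<Sum>b\<in>B. c b *s b) (\<Sum>b\<in>B. c b *s b)) = (\<Sum>b\<in>B. (cmod (c b))\<^sup>2 * Re (F b b))"
  using B orth
proof (induction B)
  case empty
  then show ?case by (simp add: herm_form_simps[OF F])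
next
  case (insert a B)
  let ?s = "\<Sum>b\<in>B. c b *s b"
  have "F a b = 0" if "b \<in> B" for b using insert.hyps(2) insert.prems[of a b] that by auto
  then have "F a ?s = 0"
    by (simp add: herm_form_sum_right[OF F] herm_form_simps[OF F])
  moreover then have "F ?s a = 0" using herm_form_eq_0_commute[OF F] by blast
  ultimately have "F (c a *s a + ?s) (c a *s a + ?s) = (cnj (c a) * c a) * F a a + F ?s ?s"
    by (simp add: herm_form_simps[OF F])
  then have "Re (F (c a *s a + ?s) (c a *s a + ?s)) = (cmod (c a))\<^sup>2 * Re (F a a) + Re (F ?s ?s)"
    unfolding cmod_power2 by (simp add: herm_form_Im_diag[OF F] power2_eq_square)
  moreover have "Re (F ?s ?s) = (\<Sum>b\<in>B. (cmod (c b))\<^sup>2 * Re (F b b))"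
    using insert.IH insert.prems by blast
  ultimately show ?case by (simp only: sum.insert[OF insert.hyps])
qed

lemma herm_form_pos_on_span:
  fixes F :: "complex ^ 'n \<Rightarrow> complex ^ 'n \<Rightarrow> complex"
  assumes F: "herm_form F" and B: "finite B"
    and orth: "\<And>a b. a \<in> B \<Longrightarrow> b \<in> B \<Longrightarrow> a \<noteq> b \<Longrightarrow> F a b = 0"
    and pos: "\<And>b. b \<in> B \<Longrightarrow> 0 < Re (F b b)" and y: "y \<in> vec.span B" "y \<noteq> 0"
  shows "0 < Re (F y y)"
proof -
  obtain c where c: "y = (\<Sum>b\<in>B. c b *s b)" using y(1) vec.span_finite[OF B] by auto
  have "\<exists>b\<in>B. c b \<noteq> 0"
  proof (rule ccontr)
    assume "\<not> ?thesis"
    then have "y = 0" unfolding c by (intro sum.neutral) simp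
    then show False using y by simp
  qed
  then obtain b where b: "b \<in> B" "c b \<noteq> 0" by blast
  have "0 < (\<Sum>b\<in>B. (cmod (c b))\<^sup>2 * Re (F b b))"
    using b pos by (intro sum_pos2[OF B b(1)]) (auto simp: less_imp_le)
  moreover have "Re (F y y) = (\<Sum>b\<in>B. (cmod (c b))\<^sup>2 * Re (F b b))"
    unfolding c by (rule herm_form_diagonal[OF F B]) (rule orth)
  ultimately show ?thesis by linarith
qed

lemma herm_form_nonpos_on_span:
  fixes F :: "complex ^ 'n \<Rightarrow> complex ^ 'n \<Rightarrow> complex"
  assumes F: "herm_form F" and B: "finite B"
    and orth: "\<And>a b. a \<in> B \<Longrightarrow> b \<in> B \<Longrightarrow> a \<noteq> b \<Longrightarrow> F a b = 0"
    and np: "\<And>b. b \<in> B \<Longrightarrow> Re (F b b) \<le> 0" and y: "y \<in> vec.span B"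
  shows "Re (F y y) \<le> 0"
proof -
  obtain c where c: "y = (\<Sum>b\<in>B. c b *s b)" using y(1) vec.span_finite[OF B] by auto
  have "(\<Sum>b\<in>B. (cmod (c b))\<^sup>2 * Re (F b b)) \<le> 0"
    using np by (intro sum_nonpos) (simp add: mult_nonneg_nonpos)
  moreover have "Re (F y y) = (\<Sum>b\<in>B. (cmod (c b))\<^sup>2 * Re (F b b))"
    unfolding c by (rule herm_form_diagonal[OF F B]) (rule orth)
  ultimately show ?thesis by linarith
qed

text \<open>Sylvester's law of inertia: a positive subspace meets the span of the basis vectors with
  nonpositive value only in 0, which bounds its dimension.\<close>

lemma positive_dim_ge_span_iff:
  fixes F :: "complex ^ 'n \<Rightarrow> complex ^ 'n \<Rightarrow> complex"
  assumes F: "herm_form F" and B: "finite B" "vec.independent B"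
    and orth: "\<And>a b. a \<in> B \<Longrightarrow> b \<in> B \<Longrightarrow> a \<noteq> b \<Longrightarrow> F a b = 0"
  shows "positive_dim_ge F (vec.span B) k \<longleftrightarrow> k \<le> card {b \<in> B. 0 < Re (F b b)}"
proof
  let ?P = "{b \<in> B. 0 < Re (F b b)}" and ?N = "{b \<in> B. Re (F b b) \<le> 0}"
  have card: "card B = card ?P + card ?N"
    using B by (subst card_Un_disjoint[symmetric]) (auto intro!: arg_cong[of _ _ card])
  have dim: "vec.dim (vec.span C) = card C" if "C \<subseteq> B" for C
    using vec.dim_span_eq_card_independent vec.independent_mono[OF B(2) that] by blast
  {
    assume "positive_dim_ge F (vec.span B) k"
    then obtain P where P: "vec.subspace P" "P \<subseteq> vec.span B" "k \<le> vec.dim P"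
      "\<And>x. x \<in> P \<Longrightarrow> x \<noteq> 0 \<Longrightarrow> 0 < Re (F x x)"
      unfolding positive_dim_ge_def by blast
    have "Re (F y y) \<le> 0" if "y \<in> vec.span ?N" for y
      using B orth that by (intro herm_form_nonpos_on_span[OF F, of ?N y]) auto
    then have "P \<inter> vec.span ?N \<subseteq> {0}" using P(4) by fastforce
    then have "vec.dim (P \<inter> vec.span ?N) = 0" by (simp only: vec.dim_eq_0)
    moreover have "vec.dim P + vec.dim (vec.span ?N)
        \<le> vec.dim (vec.span B) + vec.dim (P \<inter> vec.span ?N)"
      by (rule dim_Int_ge[OF P(1) _ _ P(2)]) (auto intro: vec.span_mono[THEN subsetD, rotated])
    moreover have "vec.dim (vec.span ?N) = card ?N" "vec.dim (vec.span B) = card B"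
      by (rule dim; blast)+
    ultimately show "k \<le> card ?P" using P(3) card by linarith
  }
  assume k: "k \<le> card ?P"
  have "0 < Re (F y y)" if "y \<in> vec.span ?P" "y \<noteq> 0" for y
    using B orth that by (intro herm_form_pos_on_span[OF F, of ?P y]) auto
  moreover have "vec.span ?P \<subseteq> vec.span B" by (rule vec.span_mono) blast
  moreover have "k \<le> vec.dim (vec.span ?P)" unfolding dim[OF Collect_restrict] by (rule k)
  ultimately show "positive_dim_ge F (vec.span B) k"
    unfolding positive_dim_ge_def using vec.subspace_span by blast
qed

text \<open>Think of an index \<open>b\<close> with \<open>0 < \<kappa> b\<close> as an opening bracket and of one with \<open>\<kappa> b < 0\<close> as
  a closing bracket, both located at \<open>h b / \<kappa> b\<close>: the indices counted at \<open>t\<close> are the opening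
  ones located above \<open>-t\<close> and the closing ones located below it.  Removing a closing bracket
  together with the nearest opening bracket above it lowers all counts by at most one.\<close>

lemma bracket_removal:
  fixes h \<kappa> :: "'a \<Rightarrow> real"
  assumes B: "finite B" and count: "\<And>t. Suc k \<le> card {b \<in> B. 0 < h b + t * \<kappa> b}"
  shows "(\<exists>b\<in>B. \<kappa> b = 0 \<and> 0 \<le> h b \<and> (\<forall>t. k \<le> card {c \<in> B - {b}. 0 < h c + t * \<kappa> c})) \<or>
    (\<exists>i\<in>B. \<exists>j\<in>B. 0 < \<kappa> i \<and> \<kappa> j < 0 \<and> h j / \<kappa> j \<le> h i / \<kappa> i \<and>
      (\<forall>t. k \<le> card {c \<in> B - {i, j}. 0 < h c + t * \<kappa> c}))"
proof -
  define l where "l b = h b / \<kappa> b" for b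
  define S where "S t = {b \<in> B. 0 < h b + t * \<kappa> b}" for t
  have fin: "finite (S t)" for t using B by (simp add: S_def)
  have count': "Suc k \<le> card (S t)" for t using count by (simp add: S_def)
  have Sdiff: "{c \<in> B - D. 0 < h c + t * \<kappa> c} = S t - D" for t D by (auto simp: S_def)
  have S_pos: "b \<in> S t \<longleftrightarrow> - t < l b" if "b \<in> B" "0 < \<kappa> b" for b t
    using that by (auto simp: S_def l_def field_simps)
  have S_neg: "b \<in> S t \<longleftrightarrow> l b < - t" if "b \<in> B" "\<kappa> b < 0" for b t
    using that by (auto simp: S_def l_def field_simps)
  have S_zero: "b \<in> S t \<longleftrightarrow> 0 < h b" if "b \<in> B" "\<kappa> b = 0" for b t
    using that by (auto simp: S_def)
  show ?thesis
  proof (cases "\<exists>b\<in>B. \<kappa> b = 0 \<and> 0 \<le> h b")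
    case True
    then obtain b where b: "b \<in> B" "\<kappa> b = 0" "0 \<le> h b" by blast
    have "k \<le> card (S t - {b})" for t
      using count'[of t] diff_card_le_card_Diff[of "{b}" "S t"] by simp
    then show ?thesis unfolding Sdiff using b by blast
  next
    case nz: False
    show ?thesis
    proof (cases "\<exists>i\<in>B. \<exists>j\<in>B. 0 < \<kappa> i \<and> \<kappa> j < 0 \<and> l j \<le> l i")
      case True
      then obtain i0 j where j: "i0 \<in> B" "j \<in> B" "0 < \<kappa> i0" "\<kappa> j < 0" "l j \<le> l i0" by blast
      let ?A = "{i \<in> B. 0 < \<kappa> i \<and> l j \<le> l i}"
      \<comment> \<open>The opening bracket nearest to \<open>j\<close> among those not below
        it.\<close>
      define i where "i = arg_min_on l ?A"
      have A: "finite ?A" "?A \<noteq> {}" using B j by auto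
      have "i \<in> ?A" unfolding i_def by (rule arg_min_if_finite(1)[OF A])
      then have i: "i \<in> B" "0 < \<kappa> i" "l j \<le> l i" by auto
      have least: "l i \<le> l b" if "b \<in> ?A" for b
        unfolding i_def by (rule arg_min_least[OF A that])
      have ij: "i \<noteq> j" using i j by auto
      have "k \<le> card (S t - {i, j})" for t
      proof (cases "i \<in> S t \<and> j \<in> S t")
        case True
        then have t: "l j < - t" "- t < l i" using S_pos i S_neg j by auto
        \<comment> \<open>Two elements are lost only when both brackets are counted at
          \<open>t\<close>. Then compare with the parameter \<open>- l j\<close>, where
          \<open>j\<close> itself is not counted: no opening bracket lies strictly between
          \<open>l j\<close> and \<open>l i\<close>, so everything else counted there is also
          counted at \<open>t\<close>.\<close>
        have "S (- l j) - {i, j} \<subseteq> S t - {i, j}"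
        proof
          fix b assume b: "b \<in> S (- l j) - {i, j}"
          then have "b \<in> B" by (simp add: S_def)
          consider "0 < \<kappa> b" | "\<kappa> b < 0" | "\<kappa> b = 0" by linarith
          then show "b \<in> S t - {i, j}"
          proof cases
            case 1
            then have "l i \<le> l b"
              using b S_pos[OF \<open>b \<in> B\<close> 1, of "- l j"] \<open>b \<in> B\<close> by (intro least) auto
            then show ?thesis using b S_pos[OF \<open>b \<in> B\<close> 1] t by auto
          next
            case 2
            then show ?thesis using b S_neg[OF \<open>b \<in> B\<close> 2] t by auto
          next
            case 3
            then show ?thesis using b S_zero[OF \<open>b \<in> B\<close> 3] by auto
          qed
        qed
        then have "card (S (- l j) - {i, j}) \<le> card (S t - {i, j})"
          using fin by (intro card_mono) auto
        moreover have "S (- l j) - {i, j} = S (- l j) - {i}"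
          using S_neg[OF j(2,4), of "- l j"] by auto
        moreover have "k \<le> card (S (- l j) - {i})"
          using count'[of "- l j"] diff_card_le_card_Diff[of "{i}" "S (- l j)"] by simp
        ultimately show ?thesis by simp
      next
        case False
        then have "\<exists>d. S t - {i, j} = S t - {d}" by auto
        then obtain d where "S t - {i, j} = S t - {d}" by blast
        then show ?thesis
          using count'[of t] diff_card_le_card_Diff[of "{d}" "S t"] by simp
      qed
      then show ?thesis unfolding Sdiff l_def[symmetric] using i j by blast
    next
      case False
      let ?P = "{b \<in> B. 0 < \<kappa> b}" and ?N = "{b \<in> B. \<kappa> b < 0}"
      \<comment> \<open>Without a matching pair all opening brackets lie below all closing ones. At
        a separating position nothing is counted, contradicting the assumed count of at least
        one.\<close>
      have "\<exists>s. (\<forall>b\<in>?P. l b \<le> s) \<and> (\<forall>b\<in>?N. s \<le> l b)"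
      proof (cases "?P = {}")
        case True
        show ?thesis
        proof (cases "?N = {}")
          case True
          then show ?thesis using \<open>?P = {}\<close> by blast
        next
          case N: False
          have "\<forall>b\<in>?N. Min (l ` ?N) \<le> l b" using B by simp
          then show ?thesis using \<open>?P = {}\<close> by blast
        qed
      next
        case P: False
        then have "Max (l ` ?P) \<in> l ` ?P" using B by (intro Max_in) auto
        then have "\<forall>b\<in>?N. Max (l ` ?P) \<le> l b" using False by fastforce
        moreover have "\<forall>b\<in>?P. l b \<le> Max (l ` ?P)" using B by simp
        ultimately show ?thesis by blast
      qed
      then obtain s where s: "\<And>b. b \<in> B \<Longrightarrow> 0 < \<kappa> b \<Longrightarrow> l b \<le> s" "\<And>b. b \<in> B \<Longrightarrow> \<kappa> b < 0 \<Longrightarrow> s \<le> l b"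
        by blast
      have "b \<notin> S (- s)" if "b \<in> B" for b
      proof -
        consider "0 < \<kappa> b" | "\<kappa> b < 0" | "\<kappa> b = 0" by linarith
        then show ?thesis
        proof cases
          case 1
          then show ?thesis using S_pos[OF that 1] s(1)[OF that 1] by simp
        next
          case 2
          then show ?thesis using S_neg[OF that 2] s(2)[OF that 2] by simp
        next
          case 3
          then show ?thesis using S_zero[OF that 3] nz that by force
        qed
      qed
      then have "S (- s) = {}" by (auto simp: S_def)
      then show ?thesis using count'[of "- s"] by simp
    qed
  qed
qed

section \<open>Subspaces isotropic for one form and nonnegative for the other\<close>

definition isotropic_nonneg_dim where
  "isotropic_nonneg_dim H K W k \<longleftrightarrow> (\<exists>V. vec.subspace V \<and> V \<subseteq> W \<and> vec.dim V = k \<and>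
     (\<forall>x\<in>V. \<forall>y\<in>V. K x y = (0::complex)) \<and> (\<forall>x\<in>V. 0 \<le> Re (H x x)))"

lemma isotropic_nonneg_dim_insert:
  fixes H K :: "complex ^ 'n \<Rightarrow> complex ^ 'n \<Rightarrow> complex"
  assumes H: "herm_form H" and K: "herm_form K" and W: "vec.subspace W" and U: "U \<subseteq> W"
    and x: "x \<in> W" "x \<notin> U" "K x x = 0" "0 \<le> Re (H x x)"
    and orth: "\<And>y. y \<in> U \<Longrightarrow> H x y = 0" "\<And>y. y \<in> U \<Longrightarrow> K x y = 0"
    and UI: "isotropic_nonneg_dim H K U k"
  shows "isotropic_nonneg_dim H K W (Suc k)"
proof -
  obtain V where V: "vec.subspace V" "V \<subseteq> U" "vec.dim V = k"
    "\<And>x y. x \<in> V \<Longrightarrow> y \<in> V \<Longrightarrow> K x y = 0" "\<And>x. x \<in> V \<Longrightarrow> 0 \<le> Re (H x x)"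
    using UI unfolding isotropic_nonneg_dim_def by blast
  have o: "\<And>y. y \<in> V \<Longrightarrow> H x y = 0" "\<And>y. y \<in> V \<Longrightarrow> K x y = 0" using V(2) orth by blast+
  let ?V = "vec.span (insert x V)"
  have "?V \<subseteq> W" using V U x W by (intro vec.span_minimal) auto
  moreover have "vec.dim ?V = Suc k" using dim_span_insert[OF V(1), of x] V x by auto
  moreover have "\<forall>y\<in>?V. \<forall>z\<in>?V. K y z = 0"
    using herm_form_vanishes_on_span_insert[OF K V(1,4) o(2) x(3)] by blast
  moreover have "\<forall>y\<in>?V. 0 \<le> Re (H y y)"
    using herm_form_nonneg_on_span_insert[OF H V(1,5) o(1) x(4)] by blast
  ultimately show ?thesis unfolding isotropic_nonneg_dim_def using vec.subspace_span by blast
qed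

text \<open>Induction on \<open>vec.dim W\<close>, gaining one dimension per step. A common
  isotropic eigenvector is divided out; otherwise both forms are diagonal, and bracket matching
  supplies one or two basis vectors to remove and an isotropic vector in their span.\<close>

lemma isotropic_nonneg_subspace_exists:
  fixes H K :: "complex ^ 'n \<Rightarrow> complex ^ 'n \<Rightarrow> complex"
  assumes H: "herm_form H" and K: "herm_form K" and "vec.subspace W"
    and "\<And>t. positive_dim_ge (\<lambda>x y. H x y + complex_of_real t * K x y) W k"
  shows "isotropic_nonneg_dim H K W k"
  using assms(3,4)
proof (induction "vec.dim W" arbitrary: W k rule: less_induct)
  case less
  note W = less.prems(1)
  have F: "herm_form (\<lambda>x y. H x y + complex_of_real t * K x y)" for t
    by (rule herm_form_add_real[OF H K])
  show ?case
  proof (cases k)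
    case 0
    then show ?thesis unfolding isotropic_nonneg_dim_def
      using vec.subspace_0[OF W]
      by (intro exI[of _ "{0}"]) (simp add: herm_form_zero_left[OF H] herm_form_zero_left[OF K])
  next
    case (Suc m)
    consider (iso) x where "x \<in> W" "x \<noteq> 0" "H x x = 0" "K x x = 0" "pencil_eigen H K W x"
      | (basis) B where "orth_basis H K W B"
      using isotropic_eigenvector_or_orth_basis[OF H K W] by (elim disjE bexE exE conjE)
    then show ?thesis
    proof cases
      case iso
      define U where "U = {y \<in> W. H x y = 0 \<and> K x y = 0}"
      \<comment> \<open>A model of \<open>U / span x\<close>: it omits \<open>x\<close>, so
        \<open>x\<close> can be put back afterwards.\<close>
      define U' where "U' = {y \<in> U. cinner x y = 0}"
      have U: "vec.subspace U" "U \<subseteq> W" "\<And>y. y \<in> U \<Longrightarrow> H x y = 0" "\<And>y. y \<in> U \<Longrightarrow> K x y = 0" "x \<in> U"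
        using subspace_pencil_kernel[OF H K W] iso by (auto simp: U_def)
      have U': "vec.subspace U'" "U' \<subseteq> U" "x \<notin> U'"
        using subspace_herm_form_kernel_right[OF herm_form_cinner U(1)] iso(2) by (auto simp: U'_def)
      have "vec.dim U' < vec.dim W"
        using dim_less_of_proper_subspace[OF U'(1) W _ iso(1) U'(3)] U U' by blast
      moreover have "positive_dim_ge (\<lambda>x y. H x y + complex_of_real t * K x y) U' m" for t
        unfolding U'_def
      proof (rule positive_dim_ge_quotient[OF F U(1,2,5)])
        fix P :: "(complex ^ 'n) set" assume P: "vec.subspace P" "P \<subseteq> W"
        have "P \<inter> U = {y \<in> P. H x y = 0 \<and> K x y = 0}" using P by (auto simp: U_def)
        then show "vec.dim P \<le> vec.dim (P \<inter> U) + 1"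
          using dim_pencil_kernel[OF H K P iso(5)] by simp
      qed (use iso U less.prems(2)[of t] Suc in auto)
      ultimately have "isotropic_nonneg_dim H K U' m" using less.hyps U'(1) by blast
      then show ?thesis unfolding Suc
        using U U' iso by (intro isotropic_nonneg_dim_insert[OF H K W, of U' x]) auto
    next
      case basis
      then have B: "finite B" "vec.independent B" "vec.span B = W"
        and orth: "\<And>a b. a \<in> B \<Longrightarrow> b \<in> B \<Longrightarrow> a \<noteq> b \<Longrightarrow> H a b = 0"
          "\<And>a b. a \<in> B \<Longrightarrow> b \<in> B \<Longrightarrow> a \<noteq> b \<Longrightarrow> K a b = 0"
        unfolding orth_basis_def by blast+
      have BW: "B \<subseteq> W" using vec.span_superset[of B] unfolding B(3) .
      define h where "h b = Re (H b b)" for b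
      define \<kappa> where "\<kappa> b = Re (K b b)" for b
      have ReF: "Re (H b b + complex_of_real t * K b b) = h b + t * \<kappa> b" for b t
        by (simp add: h_def \<kappa>_def)
      have cnt: "positive_dim_ge (\<lambda>x y. H x y + complex_of_real t * K x y) (vec.span C) l \<longleftrightarrow>
          l \<le> card {b \<in> C. 0 < h b + t * \<kappa> b}" if "C \<subseteq> B" for C t l
      proof -
        have "H a b + complex_of_real t * K a b = 0" if "a \<in> C" "b \<in> C" "a \<noteq> b" for a b
          using that orth[OF subsetD subsetD, OF \<open>C \<subseteq> B\<close> _ \<open>C \<subseteq> B\<close>] by simp
        from positive_dim_ge_span_iff[OF F finite_subset[OF that B(1)] vec.independent_mono[OF B(2) that] this]
        show ?thesis unfolding ReF .
      qed
      have notin: "b \<notin> vec.span (B - D)" if "b \<in> B" "b \<in> D" for b D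
      proof
        assume "b \<in> vec.span (B - D)"
        then have "b \<in> vec.span (B - {b})" using vec.span_mono[of "B - D" "B - {b}"] that by blast
        then show False using B(2) that unfolding vec.dependent_def by blast
      qed
      have IH: "isotropic_nonneg_dim H K (vec.span (B - D)) m"
        if "b \<in> B" "b \<in> D" and *: "\<And>t. m \<le> card {c \<in> B - D. 0 < h c + t * \<kappa> c}" for b D
      proof (rule less.hyps)
        show "vec.dim (vec.span (B - D)) < vec.dim W"
        proof (rule dim_less_of_proper_subspace[OF _ W])
          show "vec.span (B - D) \<subseteq> W" using BW W by (intro vec.span_minimal) auto
          show "b \<in> W" "b \<notin> vec.span (B - D)" using that BW notin by auto
        qed simp
        show "positive_dim_ge (\<lambda>x y. H x y + complex_of_real t * K x y) (vec.span (B - D)) m" for t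
          using * by (simp only: cnt[OF Diff_subset])
      qed simp
      have orthD: "H b y = 0" "K b y = 0" if "b \<in> B" "b \<in> D" "y \<in> vec.span (B - D)" for b D y
        using that orth[of b] by (auto intro!: herm_form_eq_0_span_right[OF H _ that(3)]
            herm_form_eq_0_span_right[OF K _ that(3)])
      have spanD: "vec.span (B - D) \<subseteq> W" for D using BW W by (intro vec.span_minimal) auto
      have count: "Suc m \<le> card {b \<in> B. 0 < h b + t * \<kappa> b}" for t
        using less.prems(2)[of t] cnt[of B t k] unfolding Suc B(3) by simp
      from bracket_removal[OF B(1) this] show ?thesis
      proof (elim disjE bexE conjE)
        fix b assume b: "b \<in> B" "\<kappa> b = 0" "0 \<le> h b" "\<forall>t. m \<le> card {c \<in> B - {b}. 0 < h c + t * \<kappa> c}"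
        have "K b b = 0" using b(2) herm_form_diag_eq_0[OF K] by (simp add: \<kappa>_def)
        then show ?thesis unfolding Suc
          using b BW notin[of b "{b}"] orthD[of b "{b}"]
          by (intro isotropic_nonneg_dim_insert[OF H K W spanD, of b "{b}"] IH[of b "{b}"]) (auto simp: h_def)
      next
        fix i j assume i: "i \<in> B" "0 < \<kappa> i" and j: "j \<in> B" "\<kappa> j < 0" and ij: "h j / \<kappa> j \<le> h i / \<kappa> i"
          and c: "\<forall>t. m \<le> card {c \<in> B - {i, j}. 0 < h c + t * \<kappa> c}"
        \<comment> \<open>The scaling makes \<open>K\<close> equal to 1 at \<open>p *s i\<close> and
          to -1 at \<open>q *s j\<close>. Hence \<open>x\<close> is isotropic for \<open>K\<close>,
          and \<open>H x x\<close> becomes the difference of the two bracket positions, which is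
          nonnegative.\<close>
        define p where "p = complex_of_real (sqrt (1 / \<kappa> i))"
        define q where "q = complex_of_real (sqrt (- (1 / \<kappa> j)))"
        define x where "x = p *s i + q *s j"
        have p: "p * p = complex_of_real (1 / \<kappa> i)" "cnj p = p" "p \<noteq> 0" and q: "q * q = complex_of_real (- (1 / \<kappa> j))" "cnj q = q"
          using i(2) j(2) by (auto simp: p_def q_def simp flip: of_real_mult)
        have ne: "i \<noteq> j" using i j by auto
        have "K x x = (p * p) * K i i + (q * q) * K j j"
          using orth(2)[OF i(1) j(1) ne] orth(2)[OF j(1) i(1) ne[symmetric]]
          by (simp add: x_def herm_form_simps[OF K] p(2) q(2))
        also have "\<dots> = 0"
          unfolding p q using i j herm_form_diag_real[OF K, of i] herm_form_diag_real[OF K, of j]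
          by (simp add: \<kappa>_def complex_eq_iff)
        finally have Kx: "K x x = 0" .
        have "H x x = (p * p) * H i i + (q * q) * H j j"
          using orth(1)[OF i(1) j(1) ne] orth(1)[OF j(1) i(1) ne[symmetric]]
          by (simp add: x_def herm_form_simps[OF H] p(2) q(2))
        then have "Re (H x x) = h i / \<kappa> i - h j / \<kappa> j"
          unfolding p q by (simp add: h_def)
        then have Hx: "0 \<le> Re (H x x)" using ij by simp
        have xW: "x \<in> W" using i j BW W by (auto simp: x_def intro!: vec.subspace_add vec.subspace_scale)
        have xn: "x \<notin> vec.span (B - {i, j})"
        proof
          assume "x \<in> vec.span (B - {i, j})"
          then have "x \<in> vec.span (B - {i})" using vec.span_mono[of "B - {i, j}" "B - {i}"] by blast
          moreover have "j \<in> vec.span (B - {i})" using j ne by (intro vec.span_base) auto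
          ultimately have "x - q *s j \<in> vec.span (B - {i})"
            by (intro vec.span_diff vec.span_scale)
          then have "p *s i \<in> vec.span (B - {i})" unfolding x_def by simp
          then have "(1 / p) *s (p *s i) \<in> vec.span (B - {i})" by (rule vec.span_scale)
          moreover have "(1 / p) *s (p *s i) = i" using p(3) by (simp add: vec.scale_scale)
          ultimately show False using notin[of i "{i}"] i by simp
        qed
        have "H x y = 0" "K x y = 0" if "y \<in> vec.span (B - {i, j})" for y
          using orthD[OF i(1) _ that] orthD[OF j(1) _ that]
          by (simp_all add: x_def herm_form_simps[OF K] herm_form_simps[OF H])
        then show ?thesis unfolding Suc
          using xW xn Kx Hx i c
          by (intro isotropic_nonneg_dim_insert[OF H K W spanD, of x "{i, j}"] IH[of i "{i, j}"]) auto
      qed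
    qed
  qed
qed

section \<open>Pairs of isotropic subspaces with opposite definiteness\<close>

definition set_sum where "set_sum E1 E2 = {u + v |u v. u \<in> E1 \<and> v \<in> (E2 :: (complex ^ 'n) set)}"

lemma subspace_set_sum: "vec.subspace E1 \<Longrightarrow> vec.subspace E2 \<Longrightarrow> vec.subspace (set_sum E1 E2)"
  unfolding set_sum_def by (rule vec.subspace_sums)

lemma set_sumE:
  assumes "x \<in> set_sum E1 E2"
  obtains u v where "u \<in> E1" "v \<in> E2" "x = u + v"
  using assms unfolding set_sum_def by blast

lemma set_sum_superset:
  assumes "vec.subspace E1" "vec.subspace E2"
  shows "E1 \<subseteq> set_sum E1 E2" "E2 \<subseteq> set_sum E1 E2"
proof -
  show "E1 \<subseteq> set_sum E1 E2"
  proof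
    fix x assume "x \<in> E1"
    then show "x \<in> set_sum E1 E2" unfolding set_sum_def
      using vec.subspace_0[OF assms(2)] by (intro CollectI exI[of _ x] exI[of _ 0]) simp
  qed
  show "E2 \<subseteq> set_sum E1 E2"
  proof
    fix x assume "x \<in> E2"
    then show "x \<in> set_sum E1 E2" unfolding set_sum_def
      using vec.subspace_0[OF assms(1)] by (intro CollectI exI[of _ 0] exI[of _ x]) simp
  qed
qed

lemma set_sum_mono: "D1 \<subseteq> E1 \<Longrightarrow> D2 \<subseteq> E2 \<Longrightarrow> set_sum D1 D2 \<subseteq> set_sum E1 E2"
  unfolding set_sum_def by blast

text \<open>Extend \<open>u\<close> to a basis of \<open>E1\<close>. As \<open>u\<close> imposes no
  condition on \<open>E2\<close>, being orthogonal to \<open>E1\<close> amounts to at most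
  \<open>vec.dim E1 - 1\<close> conditions there, fewer than \<open>vec.dim E2\<close>.\<close>

lemma radical_partner:
  fixes K :: "complex ^ 'n \<Rightarrow> complex ^ 'n \<Rightarrow> complex"
  assumes K: "herm_form K" and E1: "vec.subspace E1" and E2: "vec.subspace E2"
    and dim: "vec.dim E1 \<le> vec.dim E2"
    and u: "u \<in> E1" "u \<noteq> 0" "\<And>y. y \<in> E2 \<Longrightarrow> K u y = 0"
  shows "\<exists>v\<in>E2. v \<noteq> 0 \<and> (\<forall>y\<in>E1. K y v = 0)"
proof -
  obtain C where C: "{u} \<subseteq> C" "C \<subseteq> E1" "vec.independent C" "E1 \<subseteq> vec.span C"
    using vec.maximal_independent_subset_extend[of "{u}" E1] u by auto
  have fin: "finite C" using C(3) by (rule vec.finiteI_independent)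
  have "card C = vec.dim E1" using vec.basis_card_eq_dim C by blast
  moreover have "card (C - {u}) < card C" using fin C(1) by (intro card_Diff1_less) auto
  moreover have "vec.dim E2 \<le> vec.dim {y \<in> E2. \<forall>s\<in>C - {u}. K s y = 0} + card (C - {u})"
    using fin by (intro dim_kernel_finite[OF E2 K]) simp
  ultimately have "0 < vec.dim {y \<in> E2. \<forall>s\<in>C - {u}. K s y = 0}" using dim by linarith
  then obtain v where v: "v \<in> {y \<in> E2. \<forall>s\<in>C - {u}. K s y = 0}" "v \<noteq> 0"
    by (rule exists_nonzero_of_dim_pos)
  have "K s v = 0" if "s \<in> C" for s using v(1) u(3) that by (cases "s = u") auto
  then have "K y v = 0" if "y \<in> E1" for y
    by (rule herm_form_eq_0_span_left[OF K _ subsetD[OF C(4) that]])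
  then show ?thesis using v by blast
qed

text \<open>The phase \<open>e\<close> of \<open>c\<close> makes the cross term purely imaginary,
  and the modulus \<open>r\<close> balances the two diagonal terms.\<close>

lemma isotropic_combination:
  fixes H :: "complex ^ 'n \<Rightarrow> complex ^ 'n \<Rightarrow> complex"
  assumes H: "herm_form H" and u: "0 < Re (H u u)" and v: "Re (H v v) < 0"
  shows "\<exists>c. H (u + c *s v) (u + c *s v) = 0"
proof -
  define z where "z = H u v"
  define e where "e = (if z = 0 then 1 else \<i> * cnj (sgn z))"
  have e: "cmod e = 1" by (simp add: e_def norm_mult norm_sgn)
  have ez: "Re (e * z) = 0" by (simp add: e_def sgn_eq)
  define r where "r = sqrt (Re (H u u) / - Re (H v v))"
  have r: "r\<^sup>2 * Re (H v v) = - Re (H u u)"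
    using u v by (simp add: r_def field_simps)
  define c where "c = complex_of_real r * e"
  have c: "(cmod c)\<^sup>2 = r\<^sup>2" using e by (simp add: c_def norm_mult)
  have "H (u + c *s v) (u + c *s v) = H u u + (cnj c * c) * H v v + (c * z + cnj (c * z))"
    by (simp add: herm_form_simps[OF H] z_def herm_form_cnj[OF H] algebra_simps)
  then have "Re (H (u + c *s v) (u + c *s v)) = Re (H u u) + (cmod c)\<^sup>2 * Re (H v v) + 2 * Re (c * z)"
    unfolding cmod_power2 by (simp add: herm_form_Im_diag[OF H] power2_eq_square)
  also have "Re (c * z) = r * Re (e * z)" by (simp add: c_def mult.assoc)
  finally have "Re (H (u + c *s v) (u + c *s v)) = 0" using c r ez by simp
  then show ?thesis using herm_form_diag_eq_0[OF H] by blast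
qed

text \<open>The mixed terms \<open>H u v\<close> and \<open>H v u\<close> have the same real part,
  so the equation reduces to equality of \<open>H u u\<close> and \<open>H v v\<close>, which have
  opposite signs. It serves to show that certain sums \<open>u + v\<close> cannot be
  degenerate.\<close>

lemma definite_pair_orthogonal_eq_0:
  fixes H :: "complex ^ 'n \<Rightarrow> complex ^ 'n \<Rightarrow> complex"
  assumes H: "herm_form H"
    and pos: "u \<noteq> 0 \<Longrightarrow> 0 < Re (H u u)" and neg: "v \<noteq> 0 \<Longrightarrow> Re (H v v) < 0"
    and eq: "Re (H (u + v) u) = Re (H (u + v) v)"
  shows "u = 0 \<and> v = 0"
proof -
  have "Re (H v u) = Re (H u v)" using herm_form_cnj[OF H, of u v] by (metis cnj.sel(1))
  then have e: "Re (H u u) = Re (H v v)" using eq by (simp add: herm_form_simps[OF H])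
  have "u = 0"
    using pos neg e by (cases "v = 0") (auto simp: herm_form_simps[OF H])
  moreover have "v = 0"
    using pos neg e by (cases "u = 0") (auto simp: herm_form_simps[OF H])
  ultimately show ?thesis by blast
qed

text \<open>If \<open>K\<close> is degenerate on \<open>E1 + E2\<close>, its radical contains
  nonzero vectors of both summands, and a combination of them is \<open>H\<close>-isotropic.
  Otherwise any eigenvector is isotropic, because \<open>K x x\<close> nonzero would make the
  eigenvalue real and contradict definiteness.\<close>

lemma definite_pair_isotropic_eigenvector:
  fixes H K :: "complex ^ 'n \<Rightarrow> complex ^ 'n \<Rightarrow> complex"
  assumes H: "herm_form H" and K: "herm_form K"
    and E1: "vec.subspace E1" and E2: "vec.subspace E2"
    and dim: "vec.dim E1 = vec.dim E2" "0 < vec.dim E1"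
    and K1: "\<And>x y. x \<in> E1 \<Longrightarrow> y \<in> E1 \<Longrightarrow> K x y = 0"
    and K2: "\<And>x y. x \<in> E2 \<Longrightarrow> y \<in> E2 \<Longrightarrow> K x y = 0"
    and pos: "\<And>x. x \<in> E1 \<Longrightarrow> x \<noteq> 0 \<Longrightarrow> 0 < Re (H x x)"
    and neg: "\<And>x. x \<in> E2 \<Longrightarrow> x \<noteq> 0 \<Longrightarrow> Re (H x x) < 0"
  shows "\<exists>x\<in>set_sum E1 E2. x \<noteq> 0 \<and> H x x = 0 \<and> K x x = 0 \<and> pencil_eigen H K (set_sum E1 E2) x"
proof -
  define W where "W = set_sum E1 E2"
  have W: "vec.subspace W" "E1 \<subseteq> W" "E2 \<subseteq> W"
    unfolding W_def using subspace_set_sum set_sum_superset E1 E2 by blast+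
  have WE: "\<exists>u\<in>E1. \<exists>v\<in>E2. x = u + v" if "x \<in> W" for x
    using that unfolding W_def set_sum_def by blast
  have "\<exists>x\<in>W. x \<noteq> 0 \<and> H x x = 0 \<and> K x x = 0 \<and> pencil_eigen H K W x"
  proof (cases "\<exists>r\<in>W. r \<noteq> 0 \<and> (\<forall>y\<in>W. K y r = 0)")
    case True
    then obtain r where r: "r \<in> W" "r \<noteq> 0" "\<And>y. y \<in> W \<Longrightarrow> K y r = 0" by blast
    obtain u0 v0 where uv0: "u0 \<in> E1" "v0 \<in> E2" "r = u0 + v0" using WE[OF r(1)] by blast
    \<comment> \<open>Each component of a radical vector is itself in the radical, since
      \<open>K\<close> vanishes on each summand. If the \<open>E1\<close>-component is zero,
      \<open>radical_partner\<close> supplies a replacement.\<close>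
    have Ku0: "K u0 y = 0" if "y \<in> E2" for y
      using r(3)[of y] that W uv0 K2[OF that uv0(2)] herm_form_eq_0_commute[OF K, of y u0]
      by (auto simp: herm_form_simps[OF K])
    have Kv0: "K v0 y = 0" if "y \<in> E1" for y
      using r(3)[of y] that W uv0 K1[OF that uv0(1)] herm_form_eq_0_commute[OF K, of y v0]
      by (auto simp: herm_form_simps[OF K])
    have "\<exists>u\<in>E1. u \<noteq> 0 \<and> (\<forall>y\<in>E2. K y u = 0)"
    proof (cases "u0 = 0")
      case True
      then show ?thesis
        using radical_partner[OF K E2 E1 _ uv0(2) _ Kv0] dim uv0(3) r(2) by simp
    next
      case False
      then show ?thesis using uv0(1) Ku0 herm_form_eq_0_commute[OF K] by blast
    qed
    then obtain u where u: "u \<in> E1" "u \<noteq> 0" "\<And>y. y \<in> E2 \<Longrightarrow> K y u = 0" by blast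
    have "\<exists>v\<in>E2. v \<noteq> 0 \<and> (\<forall>y\<in>E1. K y v = 0)"
    proof (rule radical_partner[OF K E1 E2 _ u(1,2)])
      show "K u y = 0" if "y \<in> E2" for y using u(3)[OF that] herm_form_eq_0_commute[OF K] by blast
    qed (use dim in simp)
    then obtain v where v: "v \<in> E2" "v \<noteq> 0" "\<And>y. y \<in> E1 \<Longrightarrow> K y v = 0" by blast
    obtain c where c: "H (u + c *s v) (u + c *s v) = 0"
      using isotropic_combination[OF H pos[OF u(1,2)] neg[OF v(1,2)]] by blast
    define x where "x = u + c *s v"
    have cv: "c *s v \<in> E2" using v E2 by (simp add: vec.subspace_scale)
    have xW: "x \<in> W" using u cv W unfolding x_def by (intro vec.subspace_add) auto
    have "K y x = 0" if y: "y \<in> W" for y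
    proof -
      obtain a b where "a \<in> E1" "b \<in> E2" "y = a + b" using WE[OF y] by blast
      then show ?thesis
        using u v K1 K2 by (simp add: x_def herm_form_simps[OF K])
    qed
    moreover have "x \<noteq> 0"
    proof
      assume "x = 0"
      then have "H u u + H u (c *s v) = 0" "H (c *s v) u + H (c *s v) (c *s v) = 0"
        using herm_form_add_right[OF H, of u u "c *s v"] herm_form_add_right[OF H, of "c *s v" u "c *s v"]
        by (simp_all add: x_def herm_form_zero_right[OF H])
      then have "u = 0 \<and> c *s v = 0"
        using \<open>x = 0\<close> u(1) cv pos neg
        by (intro definite_pair_orthogonal_eq_0[OF H]) (auto simp: x_def herm_form_zero_left[OF H])
      then show False using u by simp
    qed
    ultimately show ?thesis using xW c unfolding pencil_eigen_def x_def by blast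
  next
    case False
    have "vec.dim E1 \<le> vec.dim W" by (rule vec.dim_subset[OF W(2)])
    then obtain x where x: "x \<in> W" "x \<noteq> 0" "pencil_eigen H K W x"
      using pencil_eigenvector[OF H K W(1)] dim unfolding pencil_eigen_def by auto
    then obtain \<mu> where \<mu>: "\<And>y. y \<in> W \<Longrightarrow> H y x = \<mu> * K y x"
      unfolding pencil_eigen_def using False by blast
    have "K x x = 0"
    proof (rule ccontr)
      assume Kx: "K x x \<noteq> 0"
      then have "\<mu> = H x x / K x x" using \<mu>[OF x(1)] by simp
      also have "\<dots> = complex_of_real (Re (H x x) / Re (K x x))"
        using herm_form_diag_real[OF H, of x] herm_form_diag_real[OF K, of x] by (metis of_real_divide)
      finally obtain m where m: "\<mu> = complex_of_real m" by blast
      obtain u v where uv: "u \<in> E1" "v \<in> E2" "x = u + v" using WE[OF x(1)] by blast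
      have "Re (H x u) = Re (H u x)" "Re (H x v) = Re (H v x)"
        using herm_form_cnj[OF H] by (metis cnj.sel(1))+
      moreover have "Re (K u v) = Re (K v u)"
        using herm_form_cnj[OF K] by (metis cnj.sel(1))
      \<comment> \<open>Because \<open>K\<close> vanishes on each summand, pairing \<open>x\<close>
        with \<open>u\<close> or with \<open>v\<close> leaves only the mixed term; with real
        \<open>m\<close> both pairings under \<open>H\<close> get the same real part.\<close>
      moreover have "H u x = m * K u v"
        using \<mu>[of u] uv W K1[OF uv(1,1)] m by (auto simp: herm_form_simps[OF K])
      moreover have "H v x = m * K v u"
        using \<mu>[of v] uv W K2[OF uv(2,2)] m by (auto simp: herm_form_simps[OF K])
      ultimately have "Re (H (u + v) u) = Re (H (u + v) v)" unfolding uv(3)[symmetric] by simp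
      then have "u = 0 \<and> v = 0"
        using uv pos neg by (intro definite_pair_orthogonal_eq_0[OF H]) auto
      then show False using x(2) uv(3) by simp
    qed
    moreover then have "H x x = 0" using \<mu>[OF x(1)] by simp
    ultimately show ?thesis using x by blast
  qed
  then show ?thesis unfolding W_def .
qed

text \<open>Induction on \<open>m\<close>: in each subspace keep the vectors orthogonal to an
  isotropic eigenvector \<open>x\<close>, apply the hypothesis to \<open>m\<close>-dimensional
  subspaces of them, and adjoin \<open>x\<close>.\<close>

lemma definite_pair_isotropic_subspace:
  fixes H K :: "complex ^ 'n \<Rightarrow> complex ^ 'n \<Rightarrow> complex"
  assumes H: "herm_form H" and K: "herm_form K"
    and "vec.subspace E1" and "vec.subspace E2"
    and "vec.dim E1 = m" "vec.dim E2 = m"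
    and "\<And>x y. x \<in> E1 \<Longrightarrow> y \<in> E1 \<Longrightarrow> K x y = 0"
    and "\<And>x y. x \<in> E2 \<Longrightarrow> y \<in> E2 \<Longrightarrow> K x y = 0"
    and "\<And>x. x \<in> E1 \<Longrightarrow> x \<noteq> 0 \<Longrightarrow> 0 < Re (H x x)"
    and "\<And>x. x \<in> E2 \<Longrightarrow> x \<noteq> 0 \<Longrightarrow> Re (H x x) < 0"
  shows "\<exists>V. vec.subspace V \<and> V \<subseteq> set_sum E1 E2 \<and> vec.dim V = m \<and>
    (\<forall>x\<in>V. \<forall>y\<in>V. H x y = 0 \<and> K x y = 0)"
  using assms(3-)
proof (induction m arbitrary: E1 E2)
  case 0
  have "0 \<in> set_sum E1 E2"
    using vec.subspace_0[OF subspace_set_sum] 0 by blast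
  then show ?case
    by (intro exI[of _ "{0}"]) (simp add: herm_form_zero_left[OF H] herm_form_zero_left[OF K])
next
  case (Suc m)
  note E = Suc.prems(1,2) and dim = Suc.prems(3,4) and K12 = Suc.prems(5,6)
    and pos = Suc.prems(7) and neg = Suc.prems(8)
  note W = subspace_set_sum[OF E] set_sum_superset[OF E]
  obtain x where x: "x \<in> set_sum E1 E2" "x \<noteq> 0" "H x x = 0" "K x x = 0"
    "pencil_eigen H K (set_sum E1 E2) x"
    using definite_pair_isotropic_eigenvector[OF H K E _ _ K12 pos neg] dim by auto
  define D where "D E = {y \<in> E. H x y = 0 \<and> K x y = 0}" for E
  have D: "vec.subspace (D E1)" "vec.subspace (D E2)"
    unfolding D_def using E by (auto intro: subspace_pencil_kernel[OF H K])
  have "m \<le> vec.dim (D E1)" "m \<le> vec.dim (D E2)"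
    using dim_pencil_kernel[OF H K E(1) W(2) x(5)] dim_pencil_kernel[OF H K E(2) W(3) x(5)] dim
    unfolding D_def by simp_all
  then obtain D1 D2 where D1: "vec.subspace D1" "D1 \<subseteq> D E1" "vec.dim D1 = m"
    and D2: "vec.subspace D2" "D2 \<subseteq> D E2" "vec.dim D2 = m"
    using exists_subspace_of_dim[OF D(1)] exists_subspace_of_dim[OF D(2)] by metis
  have DE: "y \<in> E1 \<and> H x y = 0 \<and> K x y = 0" if "y \<in> D1" for y using D1(2) that by (auto simp: D_def)
  have DE': "y \<in> E2 \<and> H x y = 0 \<and> K x y = 0" if "y \<in> D2" for y using D2(2) that by (auto simp: D_def)
  have "\<exists>V. vec.subspace V \<and> V \<subseteq> set_sum D1 D2 \<and> vec.dim V = m \<and>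
    (\<forall>x\<in>V. \<forall>y\<in>V. H x y = 0 \<and> K x y = 0)"
  proof (rule Suc.IH[OF D1(1) D2(1) D1(3) D2(3)])
    show "K y z = 0" if "y \<in> D1" "z \<in> D1" for y z
      using K12(1)[of y z] DE[OF that(1)] DE[OF that(2)] by simp
    show "K y z = 0" if "y \<in> D2" "z \<in> D2" for y z
      using K12(2)[of y z] DE'[OF that(1)] DE'[OF that(2)] by simp
    show "0 < Re (H y y)" if "y \<in> D1" "y \<noteq> 0" for y
      using pos[of y] DE[OF that(1)] that(2) by simp
    show "Re (H y y) < 0" if "y \<in> D2" "y \<noteq> 0" for y
      using neg[of y] DE'[OF that(1)] that(2) by simp
  qed
  then obtain V where V: "vec.subspace V" "V \<subseteq> set_sum D1 D2" "vec.dim V = m"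
    "\<And>x y. x \<in> V \<Longrightarrow> y \<in> V \<Longrightarrow> H x y = 0" "\<And>x y. x \<in> V \<Longrightarrow> y \<in> V \<Longrightarrow> K x y = 0" by blast
  have Vx: "H x y = 0 \<and> K x y = 0" if y: "y \<in> V" for y
  proof -
    obtain u v where "u \<in> D1" "v \<in> D2" "y = u + v" using V(2) y by (blast elim: set_sumE)
    then show ?thesis using DE DE' by (simp add: herm_form_simps[OF H] herm_form_simps[OF K])
  qed
  \<comment> \<open>If \<open>x\<close> were \<open>u + v\<close> with \<open>u\<close> in
    \<open>D1\<close> and \<open>v\<close> in \<open>D2\<close>, it would be
    \<open>H\<close>-orthogonal to both of its own components, which forces them to vanish.\<close>
  have "x \<notin> V"
  proof
    assume "x \<in> V"
    then obtain u v where uv: "u \<in> D1" "v \<in> D2" "x = u + v" using V(2) by (blast elim: set_sumE)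
    then have "H (u + v) u = 0" "H (u + v) v = 0" using DE DE' by auto
    then have "u = 0 \<and> v = 0"
      using DE[OF uv(1)] DE'[OF uv(2)] pos[of u] neg[of v]
      by (intro definite_pair_orthogonal_eq_0[OF H]) simp_all
    then show False using uv x by simp
  qed
  then have "vec.dim (vec.span (insert x V)) = Suc m" using dim_span_insert[OF V(1)] V(3) by simp
  moreover have "V \<subseteq> set_sum E1 E2"
    using V(2) set_sum_mono[of D1 E1 D2 E2] DE DE' by blast
  then have "vec.span (insert x V) \<subseteq> set_sum E1 E2"
    using x W by (intro vec.span_minimal) auto
  moreover have "H y z = 0" "K y z = 0"
    if yz: "y \<in> vec.span (insert x V)" "z \<in> vec.span (insert x V)" for y z
    using herm_form_vanishes_on_span_insert[OF H V(1,4) _ x(3) yz]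
      herm_form_vanishes_on_span_insert[OF K V(1,5) _ x(4) yz] Vx by blast+
  ultimately show ?case using vec.subspace_span by blast
qed

section \<open>Limits of subspaces\<close>

lemma closed_vec_subspace:
  assumes "vec.subspace (S :: (complex ^ 'n) set)"
  shows "closed S"
proof (rule closed_subspace)
  have "c *\<^sub>R x = complex_of_real c *s x" for c and x :: "complex ^ 'n"
    by (simp add: vec_eq_iff complex_eq_iff)
  then show "subspace S"
    using assms by (auto simp: subspace_def vec.subspace_def)
qed

lemma tendsto_vector_scalar_mult:
  fixes X :: "'a \<Rightarrow> complex ^ 'n"
  assumes "(X \<longlongrightarrow> x) F"
  shows "((\<lambda>n. c *s X n) \<longlongrightarrow> c *s x) F"
  using assms by (intro vec_tendstoI) (auto intro!: tendsto_intros)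

text \<open>In coordinates a form is a polynomial in the entries and their conjugates, hence jointly
  continuous.\<close>

lemma tendsto_herm_form:
  fixes F :: "complex ^ 'n \<Rightarrow> complex ^ 'n \<Rightarrow> complex"
  assumes F: "herm_form F" and X: "(X \<longlongrightarrow> x) net" and Y: "(Y \<longlongrightarrow> y) net"
  shows "((\<lambda>n. F (X n) (Y n)) \<longlongrightarrow> F x y) net"
proof -
  have expand: "F x y = (\<Sum>j\<in>UNIV. y $ j * cnj (\<Sum>i\<in>UNIV. x $ i * F (axis j 1) (axis i 1)))" for x y
  proof -
    have right: "F z w = (\<Sum>j\<in>UNIV. w $ j * F z (axis j 1))" for z w
      using herm_form_sum_right[OF F, of z "\<lambda>j. w $ j *s axis j 1" UNIV]
      by (simp add: basis_expansion herm_form_simps[OF F])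
    have "F x (axis j 1) = cnj (\<Sum>i\<in>UNIV. x $ i * F (axis j 1) (axis i 1))" for j
      using right[of "axis j 1" x] herm_form_cnj[OF F, of "axis j 1" x] by simp
    then show ?thesis using right[of x y] by simp
  qed
  have "((\<lambda>n. \<Sum>j\<in>UNIV. Y n $ j * cnj (\<Sum>i\<in>UNIV. X n $ i * F (axis j 1) (axis i 1))) \<longlongrightarrow>
      (\<Sum>j\<in>UNIV. y $ j * cnj (\<Sum>i\<in>UNIV. x $ i * F (axis j 1) (axis i 1)))) net"
    using X Y by (auto intro!: tendsto_intros)
  then show ?thesis by (simp only: expand[symmetric])
qed

lemma orthogonal_independent:
  assumes B: "finite B" and ne: "0 \<notin> B"
    and orth: "\<And>a b. a \<in> B \<Longrightarrow> b \<in> B \<Longrightarrow> a \<noteq> b \<Longrightarrow> cinner a b = 0"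
  shows "vec.independent (B :: (complex ^ 'n) set)"
proof (rule vec.independent_if_scalars_zero[OF B])
  fix f b assume s: "(\<Sum>x\<in>B. f x *s x) = 0" and b: "b \<in> B"
  have "cinner b (\<Sum>x\<in>B. f x *s x) = (\<Sum>x\<in>B. f x * cinner b x)"
    by (simp add: herm_form_sum_right[OF herm_form_cinner] herm_form_simps[OF herm_form_cinner])
  also have "\<dots> = (\<Sum>x\<in>B. if x = b then f b * cinner b b else 0)"
    using b orth by (intro sum.cong) auto
  also have "\<dots> = f b * cinner b b" using b B by simp
  finally have "f b * cinner b b = 0" unfolding s by (simp add: herm_form_zero_right[OF herm_form_cinner])
  then show "f b = 0" using ne b by auto
qed

text \<open>Diagonalisation with \<open>cinner\<close> in both roles replaces Gram-Schmidt; an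
  isotropic vector of \<open>cinner\<close> would be 0.\<close>

lemma orthogonal_basis_exists:
  assumes W: "vec.subspace (W :: (complex ^ 'n) set)"
  obtains B where "orth_basis cinner cinner W B"
  using isotropic_eigenvector_or_orth_basis[OF herm_form_cinner herm_form_cinner W] by auto

text \<open>The frame is stored as the rows of a square matrix, with zero rows outside
  \<open>J\<close>. Frames of all subspaces of a given dimension thus lie in one Euclidean space,
  where compactness is available.\<close>

lemma orthonormal_frame_exists:
  fixes J :: "'n::finite set" and W :: "(complex ^ 'n) set"
  assumes W: "vec.subspace W" and dim: "vec.dim W = card J"
  shows "\<exists>f :: complex ^ 'n ^ 'n. (\<forall>i\<in>J. f $ i \<in> W) \<and> (\<forall>i. i \<notin> J \<longrightarrow> f $ i = 0) \<and>
    (\<forall>i\<in>J. \<forall>j\<in>J. cinner (f $ i) (f $ j) = (if i = j then 1 else 0))"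
proof -
  obtain B where "orth_basis cinner cinner W B" using orthogonal_basis_exists[OF W] .
  then have B: "finite B" "vec.independent B" "vec.span B = W"
    "\<And>a b. a \<in> B \<Longrightarrow> b \<in> B \<Longrightarrow> a \<noteq> b \<Longrightarrow> cinner a b = 0"
    unfolding orth_basis_def by blast+
  have BW: "B \<subseteq> W" using vec.span_superset[of B] unfolding B(3) .
  have "card J = card B" using vec.dim_span_eq_card_independent[OF B(2)] B(3) dim by simp
  then obtain \<phi> where \<phi>: "bij_betw \<phi> J B" using finite_same_card_bij[of J B] B(1) by auto
  have in_B: "\<phi> i \<in> B" if "i \<in> J" for i using \<phi> that bij_betwE by blast
  have ne: "\<phi> i \<noteq> 0" if "i \<in> J" for i
    using in_B[OF that] B(2) vec.dependent_zero by metis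
  define f :: "complex ^ 'n ^ 'n" where
    "f = (\<chi> i. if i \<in> J then complex_of_real (1 / norm (\<phi> i)) *s \<phi> i else 0)"
  have "f $ i \<in> W" if "i \<in> J" for i
    using in_B[OF that] BW W that by (auto simp: f_def intro!: vec.subspace_scale)
  moreover have "cinner (f $ i) (f $ j) = (if i = j then 1 else 0)" if ij: "i \<in> J" "j \<in> J" for i j
  proof (cases "i = j")
    case True
    have "cinner (\<phi> i) (\<phi> i) = complex_of_real ((norm (\<phi> i))\<^sup>2)"
      using herm_form_diag_real[OF herm_form_cinner, of "\<phi> i"] unfolding Re_cinner_self .
    then show ?thesis using True ij ne[of i]
      by (simp add: f_def herm_form_simps[OF herm_form_cinner] power2_eq_square)
  next
    case False
    then have "\<phi> i \<noteq> \<phi> j" using \<phi> ij by (auto simp: bij_betw_def inj_on_def)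
    then have "cinner (\<phi> i) (\<phi> j) = 0" using B(4) in_B ij by blast
    then show ?thesis using False ij by (simp add: f_def herm_form_simps[OF herm_form_cinner])
  qed
  moreover have "\<forall>i. i \<notin> J \<longrightarrow> f $ i = 0" by (simp add: f_def)
  ultimately show ?thesis by blast
qed

text \<open>Compactness of the Grassmannian: orthonormal frames are bounded, and orthonormality
  survives in the limit of a subsequence, so no dimension is lost.\<close>

lemma subspace_sequence_limit:
  fixes V :: "nat \<Rightarrow> (complex ^ 'n) set"
  assumes V: "\<And>n. vec.subspace (V n)" "\<And>n. vec.dim (V n) = k"
  shows "\<exists>L r. vec.subspace L \<and> vec.dim L = k \<and> strict_mono (r :: nat \<Rightarrow> nat) \<and>
    (\<forall>x\<in>L. \<exists>X. (\<forall>n. X n \<in> V (r n)) \<and> X \<longlonglongrightarrow> x)"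
proof -
  have "k \<le> CARD('n)"
    using vec.dim_subset_UNIV[of "V 0"] V(2) by (simp add: vec.dimension_def card_cart_basis)
  then obtain J :: "'n set" where J: "card J = k"
    using obtain_subset_with_card_n[of k "UNIV :: 'n set"] by auto
  have "\<forall>n. \<exists>f :: complex ^ 'n ^ 'n. (\<forall>i\<in>J. f $ i \<in> V n) \<and> (\<forall>i. i \<notin> J \<longrightarrow> f $ i = 0) \<and>
    (\<forall>i\<in>J. \<forall>j\<in>J. cinner (f $ i) (f $ j) = (if i = j then 1 else 0))"
    using orthonormal_frame_exists[OF V(1)] V(2) J by blast
  then obtain f :: "nat \<Rightarrow> complex ^ 'n ^ 'n" where
    f: "\<And>n i. i \<in> J \<Longrightarrow> f n $ i \<in> V n" "\<And>n i. i \<notin> J \<Longrightarrow> f n $ i = 0"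
      "\<And>n i j. i \<in> J \<Longrightarrow> j \<in> J \<Longrightarrow> cinner (f n $ i) (f n $ j) = (if i = j then 1 else 0)"
    by metis
  have "norm (f n $ i) \<le> 1" for n i
  proof (cases "i \<in> J")
    case True
    then have "(norm (f n $ i))\<^sup>2 = 1" using f(3)[of i i n] Re_cinner_self[of "f n $ i"] by simp
    then show ?thesis by (auto simp: power2_eq_1_iff)
  next
    case False
    then show ?thesis using f(2) by simp
  qed
  then have "norm (f n) \<le> real CARD('n)" for n
    using L2_set_le_sum[of UNIV "\<lambda>i. norm (f n $ i)"] sum_bounded_above[of UNIV "\<lambda>i. norm (f n $ i)" 1]
    unfolding norm_vec_def by simp
  then have "bounded (range f)" by (auto simp: bounded_iff)
  then obtain l r where r: "strict_mono r" and l: "(f \<circ> r) \<longlonglongrightarrow> l"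
    using bounded_imp_convergent_subsequence by blast
  have li: "(\<lambda>n. f (r n) $ i) \<longlonglongrightarrow> l $ i" for i
    using tendsto_vec_nth[OF l, of i] by (simp add: o_def)
  have orth: "cinner (l $ i) (l $ j) = (if i = j then 1 else 0)" if "i \<in> J" "j \<in> J" for i j
    using tendsto_herm_form[OF herm_form_cinner li[of i] li[of j]] f(3)[OF that]
    by (simp add: LIMSEQ_const_iff)
  have inj: "inj_on (($) l) J"
    by (rule inj_onI) (metis orth zero_neq_one)
  have "l $ i \<noteq> 0" if "i \<in> J" for i
    using orth[OF that that] by (metis cinner_self_eq_0 zero_neq_one)
  then have "vec.independent (($) l ` J)"
    using orth by (intro orthogonal_independent) auto
  then have "vec.dim (vec.span (($) l ` J)) = k"
    using vec.dim_span_eq_card_independent card_image[OF inj] J by metis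
  moreover have "\<exists>X. (\<forall>n. X n \<in> V (r n)) \<and> X \<longlonglongrightarrow> x" if "x \<in> vec.span (($) l ` J)" for x
    using that
  proof (induction rule: vec.span_induct_alt)
    case base
    then show ?case using V(1) by (intro exI[of _ "\<lambda>_. 0"]) (simp add: vec.subspace_0)
  next
    case (step c b y)
    then obtain i X where "i \<in> J" and "b = l $ i" and "\<And>n. X n \<in> V (r n)" and "X \<longlonglongrightarrow> y" by auto
    have "(\<lambda>n. c *s (f (r n) $ i) + X n) \<longlonglongrightarrow> c *s b + y"
      unfolding \<open>b = l $ i\<close> by (intro tendsto_add tendsto_vector_scalar_mult li) fact
    moreover have "c *s (f (r n) $ i) + X n \<in> V (r n)" for n
      using V(1) f(1) \<open>i \<in> J\<close> \<open>X n \<in> V (r n)\<close> by (intro vec.subspace_add vec.subspace_scale)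
    ultimately show ?case by (intro exI[of _ "\<lambda>n. c *s (f (r n) $ i) + X n"]) simp
  qed
  ultimately show ?thesis using r vec.subspace_span by blast
qed

section \<open>Semidefinite pairs\<close>

text \<open>Otherwise moving from \<open>y\<close> far enough along a multiple of \<open>x\<close>
  makes the form negative: its value is affine in \<open>t\<close>, and \<open>t\<close> is chosen
  to give -1.\<close>

lemma semidefinite_radical:
  fixes H :: "complex ^ 'n \<Rightarrow> complex ^ 'n \<Rightarrow> complex"
  assumes H: "herm_form H" and E: "vec.subspace E" and nonneg: "\<And>x. x \<in> E \<Longrightarrow> 0 \<le> Re (H x x)"
    and x: "x \<in> E" "H x x = 0" and y: "y \<in> E"
  shows "H x y = 0"
proof (rule ccontr)
  assume "H x y \<noteq> 0"
  define z where "z = H x y"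
  have z: "0 < (cmod z)\<^sup>2" using \<open>H x y \<noteq> 0\<close> by (simp add: z_def)
  define t where "t = - (Re (H y y) + 1) / (2 * (cmod z)\<^sup>2)"
  let ?w = "(complex_of_real t * z) *s x + y"
  have "?w \<in> E" using E x y by (intro vec.subspace_add vec.subspace_scale)
  then have "0 \<le> Re (H ?w ?w)" by (rule nonneg)
  also have "H ?w ?w = complex_of_real t * (cnj z * z) + complex_of_real t * (z * cnj z) + H y y"
    by (simp add: herm_form_simps[OF H] x(2) z_def herm_form_cnj[OF H])
  also have "Re \<dots> = 2 * t * (cmod z)\<^sup>2 + Re (H y y)"
    unfolding cmod_power2 by (simp add: power2_eq_square algebra_simps)
  also have "\<dots> = -1" using z by (simp add: t_def field_simps)
  finally show False by simp
qed

lemma complement_exists: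
  fixes F E :: "(complex ^ 'n) set"
  assumes F: "vec.subspace F" and E: "vec.subspace E" and FE: "F \<subseteq> E"
  obtains D where "vec.subspace D" "D \<subseteq> E" "D \<inter> F \<subseteq> {0}" "vec.dim D + vec.dim F = vec.dim E"
proof -
  obtain C where C: "finite C" "C \<subseteq> F" "vec.span C = F" "card C = vec.dim F"
    using vec.basis_subspace_exists[OF F] by metis
  let ?D = "{y \<in> E. \<forall>b\<in>C. cinner b y = 0}"
  have D: "vec.subspace ?D"
    using E by (auto simp: vec.subspace_def herm_form_simps[OF herm_form_cinner])
  have triv: "?D \<inter> F \<subseteq> {0}"
  proof
    fix y assume y: "y \<in> ?D \<inter> F"
    then have "y \<in> vec.span C" unfolding C(3) by blast
    have "cinner y y = 0"
      by (rule herm_form_eq_0_span_left[OF herm_form_cinner _ \<open>y \<in> vec.span C\<close>]) (use y in blast)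
    then show "y \<in> {0}" by simp
  qed
  have "vec.dim E \<le> vec.dim ?D + vec.dim F"
    using dim_kernel_finite[OF E herm_form_cinner C(1)] C(4) by simp
  moreover have "vec.dim ?D + vec.dim F \<le> vec.dim E + vec.dim (?D \<inter> F)"
    using FE by (intro dim_Int_ge[OF D F E]) auto
  moreover have "vec.dim (?D \<inter> F) = 0" using triv by (simp only: vec.dim_eq_0)
  ultimately have "vec.dim ?D + vec.dim F = vec.dim E" by linarith
  then show ?thesis using that[of ?D] D triv by blast
qed

text \<open>Let \<open>g\<close> be linear with \<open>g\<close> the identity on \<open>E1\<close>
  and zero on \<open>E2\<close>. Then \<open>G\<close> is the squared length of the
  \<open>g\<close>-part minus that of the remainder, and one of the two vanishes on each
  subspace.\<close>

lemma separating_herm_form: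
  fixes E1 E2 :: "(complex ^ 'n) set"
  assumes E1: "vec.subspace E1" and E2: "vec.subspace E2" and triv: "E1 \<inter> E2 \<subseteq> {0}"
  shows "\<exists>G. herm_form G \<and> (\<forall>x\<in>E1. x \<noteq> 0 \<longrightarrow> 0 < Re (G x x)) \<and>
    (\<forall>x\<in>E2. x \<noteq> 0 \<longrightarrow> Re (G x x) < 0)"
proof -
  obtain B1 where B1: "finite B1" "B1 \<subseteq> E1" "vec.independent B1" "vec.span B1 = E1" "card B1 = vec.dim E1"
    using vec.basis_subspace_exists[OF E1] by metis
  obtain B2 where B2: "finite B2" "B2 \<subseteq> E2" "vec.independent B2" "vec.span B2 = E2" "card B2 = vec.dim E2"
    using vec.basis_subspace_exists[OF E2] by metis
  have disj: "b \<notin> B1" if "b \<in> B2" for b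
  proof
    assume "b \<in> B1"
    then have "b = 0" using that B1(2) B2(2) triv by blast
    then show False using that vec.dependent_zero[of B2] B2(3) by blast
  qed
  have "vec.independent (B1 \<union> B2)"
  proof (rule vec.card_le_dim_spanning)
    show "B1 \<union> B2 \<subseteq> set_sum E1 E2" using B1 B2 set_sum_superset[OF E1 E2] by blast
    show "set_sum E1 E2 \<subseteq> vec.span (B1 \<union> B2)"
      unfolding set_sum_def vec.span_Un B1(4) B2(4) by blast
    have "vec.dim (E1 \<inter> E2) = 0" using triv by (simp only: vec.dim_eq_0)
    then have "vec.dim (set_sum E1 E2) = card B1 + card B2"
      using vec.dim_sums_Int[OF E1 E2] B1(5) B2(5) unfolding set_sum_def by linarith
    then show "card (B1 \<union> B2) \<le> vec.dim (set_sum E1 E2)" using card_Un_le[of B1 B2] by simp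
  qed (use B1 B2 in simp)
  then obtain g where g: "Vector_Spaces.linear (*s) (*s) g"
    "\<And>x. x \<in> B1 \<union> B2 \<Longrightarrow> g x = (if x \<in> B1 then x else (0 :: complex ^ 'n))"
    using vec.linear_independent_extend[of "B1 \<union> B2" "\<lambda>x. if x \<in> B1 then x else 0"] by blast
  have lin: "g (x + y) = g x + g y" "g (c *s x) = c *s g x" for x y c
    using g(1) unfolding Vector_Spaces.linear_iff by blast+
  have zero: "g 0 = 0" using lin(2)[of 0 0] by simp
  have g1: "g x = x" if "x \<in> E1" for x
    using that unfolding B1(4)[symmetric]
    by (induction rule: vec.span_induct_alt) (simp_all add: zero lin g(2))
  have g2: "g x = 0" if "x \<in> E2" for x
    using that unfolding B2(4)[symmetric]
    by (induction rule: vec.span_induct_alt) (simp_all add: zero lin g(2) disj)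
  define I :: "complex ^ 'n \<Rightarrow> complex ^ 'n \<Rightarrow> complex" where "I = cinner"
  have I: "herm_form I" unfolding I_def by (rule herm_form_cinner)
  define G where "G x y = I (g x) (g y) - I (x - g x) (y - g y)" for x y
  have d: "x + y - g (x + y) = (x - g x) + (y - g y)" "c *s x - g (c *s x) = c *s (x - g x)" for x y c
    by (simp_all add: lin vec.scale_right_diff_distrib)
  have "herm_form G"
    unfolding herm_form_def
  proof (intro conjI allI)
    show "G x (y + z) = G x y + G x z" for x y z
      unfolding G_def d by (simp only: lin herm_form_add_right[OF I]) simp
    show "G x (c *s y) = c * G x y" for x y c
      unfolding G_def d by (simp only: lin herm_form_scale_right[OF I] right_diff_distrib)
    show "G y x = cnj (G x y)" for x y
      unfolding G_def by (simp only: complex_cnj_diff herm_form_cnj[OF I])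
  qed
  moreover have "0 < Re (G x x)" if "x \<in> E1" "x \<noteq> 0" for x
    using that(2) by (simp add: G_def g1[OF that(1)] herm_form_zero_left[OF I]) (simp add: I_def Re_cinner_self)
  moreover have "Re (G x x) < 0" if "x \<in> E2" "x \<noteq> 0" for x
    using that(2) by (simp add: G_def g2[OF that(1)] herm_form_zero_left[OF I]) (simp add: I_def Re_cinner_self)
  ultimately show ?thesis by blast
qed

text \<open>After splitting off \<open>F = E1 \<inter> E2\<close>, the complements \<open>D1\<close>
  and \<open>D2\<close> meet trivially, so adding a small multiple of a separating form makes
  \<open>H\<close> definite on each. A limit \<open>L\<close> of the isotropic subspaces obtained,
  together with \<open>F\<close>, has dimension \<open>k\<close>.\<close>

lemma semidefinite_pair_isotropic_subspace:
  fixes H K :: "complex ^ 'n \<Rightarrow> complex ^ 'n \<Rightarrow> complex"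
  assumes H: "herm_form H" and K: "herm_form K"
    and E1: "vec.subspace E1" and E2: "vec.subspace E2"
    and dim: "vec.dim E1 = k" "vec.dim E2 = k"
    and K1: "\<And>x y. x \<in> E1 \<Longrightarrow> y \<in> E1 \<Longrightarrow> K x y = 0"
    and K2: "\<And>x y. x \<in> E2 \<Longrightarrow> y \<in> E2 \<Longrightarrow> K x y = 0"
    and pos: "\<And>x. x \<in> E1 \<Longrightarrow> 0 \<le> Re (H x x)"
    and neg: "\<And>x. x \<in> E2 \<Longrightarrow> Re (H x x) \<le> 0"
  shows "\<exists>V. vec.subspace V \<and> vec.dim V = k \<and> (\<forall>x\<in>V. \<forall>y\<in>V. H x y = 0 \<and> K x y = 0)"
proof -
  define F where "F = E1 \<inter> E2"
  have F: "vec.subspace F" "F \<subseteq> E1" "F \<subseteq> E2" unfolding F_def using E1 E2 by (auto simp: vec.subspace_inter)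
  have HF: "H x x = 0" if "x \<in> F" for x
    using pos[of x] neg[of x] that F herm_form_diag_eq_0[OF H, of x] by force
  have HF1: "H x y = 0" if "x \<in> F" "y \<in> E1" for x y
    using semidefinite_radical[OF H E1 pos _ HF[OF that(1)] that(2)] that F by blast
  have HF2: "H x y = 0" if "x \<in> F" "y \<in> E2" for x y
    using semidefinite_radical[OF herm_form_uminus[OF H] E2, of x y] neg HF[OF that(1)] that F by auto
  \<comment> \<open>On \<open>F\<close> the form \<open>H\<close> is both nonnegative and
    nonpositive, hence zero, and semidefiniteness on \<open>E1\<close> and on \<open>E2\<close> puts
    \<open>F\<close> in the radical of each restriction.\<close>
  have F_rad: "H x y = 0" "K x y = 0" if xF: "x \<in> F" and yE: "y \<in> set_sum E1 E2" for x y
  proof -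
    obtain u v where uv: "u \<in> E1" "v \<in> E2" "y = u + v" using yE by (rule set_sumE)
    have "K x u = 0" "K x v = 0" using K1 K2 uv xF F by blast+
    then show "H x y = 0" "K x y = 0"
      using HF1[OF xF uv(1)] HF2[OF xF uv(2)] uv(3)
      by (simp_all add: herm_form_simps[OF H] herm_form_simps[OF K])
  qed
  obtain D1 where D1: "vec.subspace D1" "D1 \<subseteq> E1" "D1 \<inter> F \<subseteq> {0}" "vec.dim D1 + vec.dim F = vec.dim E1"
    by (rule complement_exists[OF F(1) E1 F(2)])
  obtain D2 where D2: "vec.subspace D2" "D2 \<subseteq> E2" "D2 \<inter> F \<subseteq> {0}" "vec.dim D2 + vec.dim F = vec.dim E2"
    by (rule complement_exists[OF F(1) E2 F(3)])
  define m where "m = vec.dim D1"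
  have m: "vec.dim D1 = m" "vec.dim D2 = m" "m + vec.dim F = k" using D1(4) D2(4) dim by (simp_all add: m_def)
  have triv: "D1 \<inter> D2 \<subseteq> {0}" using D1 D2 unfolding F_def by blast
  obtain G where G: "herm_form G" "\<And>x. x \<in> D1 \<Longrightarrow> x \<noteq> 0 \<Longrightarrow> 0 < Re (G x x)"
    "\<And>x. x \<in> D2 \<Longrightarrow> x \<noteq> 0 \<Longrightarrow> Re (G x x) < 0"
    using separating_herm_form[OF D1(1) D2(1) triv] by blast
  define \<epsilon> where "\<epsilon> n = inverse (real (Suc n))" for n
  have \<epsilon>: "0 < \<epsilon> n" for n by (simp add: \<epsilon>_def)
  have "\<exists>V. vec.subspace V \<and> V \<subseteq> set_sum D1 D2 \<and> vec.dim V = m \<and>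
      (\<forall>x\<in>V. \<forall>y\<in>V. H x y + complex_of_real (\<epsilon> n) * G x y = 0 \<and> K x y = 0)" for n
  proof (rule definite_pair_isotropic_subspace[OF herm_form_add_real[OF H G(1)] K D1(1) D2(1) m(1,2)])
    show "0 < Re (H x x + complex_of_real (\<epsilon> n) * G x x)" if "x \<in> D1" "x \<noteq> 0" for x
      using pos[of x] G(2)[OF that] \<epsilon>[of n] D1(2) that(1) by (simp add: add_nonneg_pos subset_iff)
    show "Re (H x x + complex_of_real (\<epsilon> n) * G x x) < 0" if "x \<in> D2" "x \<noteq> 0" for x
      using neg[of x] G(3)[OF that] \<epsilon>[of n] D2(2) that(1)
      by (simp add: add_nonpos_neg mult_pos_neg subset_iff)
  qed (use K1 K2 D1(2) D2(2) in blast)+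
  then obtain V where V: "\<And>n. vec.subspace (V n)" "\<And>n. V n \<subseteq> set_sum D1 D2" "\<And>n. vec.dim (V n) = m"
    "\<And>n x y. x \<in> V n \<Longrightarrow> y \<in> V n \<Longrightarrow> H x y + complex_of_real (\<epsilon> n) * G x y = 0"
    "\<And>n x y. x \<in> V n \<Longrightarrow> y \<in> V n \<Longrightarrow> K x y = 0"
    by metis
  obtain L r where L: "vec.subspace L" "vec.dim L = m" "strict_mono r"
    "\<And>x. x \<in> L \<Longrightarrow> \<exists>X. (\<forall>n. X n \<in> V (r n)) \<and> X \<longlonglongrightarrow> x"
    using subspace_sequence_limit[of V, OF V(1,3)] by blast
  have \<epsilon>r: "(\<lambda>n. complex_of_real (\<epsilon> (r n))) \<longlonglongrightarrow> complex_of_real 0"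
    using LIMSEQ_subseq_LIMSEQ[OF LIMSEQ_inverse_real_of_nat L(3)]
    by (intro tendsto_of_real) (simp add: o_def \<epsilon>_def)
  have HL: "H x y = 0 \<and> K x y = 0" if "x \<in> L" "y \<in> L" for x y
  proof -
    obtain X where X: "\<And>n. X n \<in> V (r n)" "X \<longlonglongrightarrow> x" using L(4)[OF \<open>x \<in> L\<close>] by blast
    obtain Y where Y: "\<And>n. Y n \<in> V (r n)" "Y \<longlonglongrightarrow> y" using L(4)[OF \<open>y \<in> L\<close>] by blast
    have "(\<lambda>n. H (X n) (Y n) + complex_of_real (\<epsilon> (r n)) * G (X n) (Y n))
        \<longlonglongrightarrow> H x y + complex_of_real 0 * G x y"
      by (intro tendsto_intros \<epsilon>r tendsto_herm_form[OF H] tendsto_herm_form[OF G(1)] X Y)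
    moreover have "(\<lambda>n. K (X n) (Y n)) \<longlonglongrightarrow> K x y"
      by (intro tendsto_herm_form[OF K] X Y)
    ultimately show ?thesis
      using V(4)[OF X(1) Y(1)] V(5)[OF X(1) Y(1)] by (simp add: LIMSEQ_const_iff)
  qed
  have LD: "L \<subseteq> set_sum D1 D2"
  proof
    fix x assume "x \<in> L"
    then obtain X where X: "\<And>n. X n \<in> V (r n)" "X \<longlonglongrightarrow> x" using L(4) by blast
    have "closed (set_sum D1 D2)" by (intro closed_vec_subspace subspace_set_sum D1 D2)
    then show "x \<in> set_sum D1 D2"
      using X V(2) unfolding closed_sequential_limits by blast
  qed
  \<comment> \<open>Write \<open>x\<close> as \<open>u + v\<close> with \<open>u\<close> in
    \<open>D1\<close> and \<open>v\<close> in \<open>D2\<close>. Then \<open>v\<close> lies in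
    \<open>E1\<close> too, so it is in \<open>D2 \<inter> F\<close> and vanishes; now
    \<open>x\<close> is in \<open>D1 \<inter> F\<close>.\<close>
  have "L \<inter> F \<subseteq> {0}"
  proof
    fix x assume x: "x \<in> L \<inter> F"
    then obtain u v where uv: "u \<in> D1" "v \<in> D2" "x = u + v" using LD by (blast elim: set_sumE)
    have "v = x - u" using uv by simp
    moreover have "x \<in> E1" "u \<in> E1" using x F(2) uv(1) D1(2) by blast+
    ultimately have "v \<in> E1" using vec.subspace_diff[OF E1] by blast
    then have "v = 0" using uv D2 unfolding F_def by blast
    then show "x \<in> {0}" using x uv D1 by auto
  qed
  then have "vec.dim (L \<inter> F) = 0" by (simp only: vec.dim_eq_0)
  then have "vec.dim (set_sum L F) = k"
    using vec.dim_sums_Int[OF L(1) F(1)] L(2) m(3) unfolding set_sum_def by linarith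
  moreover have "H x y = 0 \<and> K x y = 0" if xy: "x \<in> set_sum L F" "y \<in> set_sum L F" for x y
  proof -
    obtain a f where a: "a \<in> L" "f \<in> F" "x = a + f" using xy(1) by (rule set_sumE)
    obtain b g where b: "b \<in> L" "g \<in> F" "y = b + g" using xy(2) by (rule set_sumE)
    have sub: "L \<subseteq> set_sum E1 E2" "F \<subseteq> set_sum E1 E2"
      using LD set_sum_mono[OF D1(2) D2(2)] F(2) set_sum_superset[OF E1 E2] by blast+
    have "H f b = 0" "H f g = 0" "H g a = 0" "K f b = 0" "K f g = 0" "K g a = 0"
      using F_rad a b sub by blast+
    moreover then have "H a g = 0" "K a g = 0"
      using herm_form_eq_0_commute[OF H] herm_form_eq_0_commute[OF K] by blast+
    ultimately show ?thesis using HL[OF a(1) b(1)] a b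
      by (simp add: herm_form_simps[OF H] herm_form_simps[OF K])
  qed
  ultimately show ?thesis using subspace_set_sum[OF L(1) F(1)] by blast
qed

text \<open>Removes the shift by \<open>e\<close>: both the vanishing of \<open>K\<close> and the
  weak inequality for \<open>H\<close> pass to limits of subspaces.\<close>

lemma isotropic_nonneg_dim_limit:
  fixes H K :: "complex ^ 'n \<Rightarrow> complex ^ 'n \<Rightarrow> complex"
  assumes H: "herm_form H" and K: "herm_form K"
    and ex: "\<And>e. 0 < e \<Longrightarrow> isotropic_nonneg_dim (\<lambda>x y. H x y + complex_of_real e * cinner x y) K UNIV k"
  shows "isotropic_nonneg_dim H K UNIV k"
proof -
  define \<epsilon> where "\<epsilon> n = inverse (real (Suc n))" for n
  have "isotropic_nonneg_dim (\<lambda>x y. H x y + complex_of_real (\<epsilon> n) * cinner x y) K UNIV k" for n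
    by (rule ex) (simp add: \<epsilon>_def)
  then obtain V where V: "\<And>n. vec.subspace (V n)" "\<And>n. vec.dim (V n) = k"
    "\<And>n x y. x \<in> V n \<Longrightarrow> y \<in> V n \<Longrightarrow> K x y = 0"
    "\<And>n x. x \<in> V n \<Longrightarrow> 0 \<le> Re (H x x + complex_of_real (\<epsilon> n) * cinner x x)"
    unfolding isotropic_nonneg_dim_def by metis
  obtain L r where L: "vec.subspace L" "vec.dim L = k" "strict_mono r"
    "\<And>x. x \<in> L \<Longrightarrow> \<exists>X. (\<forall>n. X n \<in> V (r n)) \<and> X \<longlonglongrightarrow> x"
    using subspace_sequence_limit[of V, OF V(1,2)] by blast
  have \<epsilon>r: "(\<lambda>n. complex_of_real (\<epsilon> (r n))) \<longlonglongrightarrow> complex_of_real 0"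
    using LIMSEQ_subseq_LIMSEQ[OF LIMSEQ_inverse_real_of_nat L(3)]
    by (intro tendsto_of_real) (simp add: o_def \<epsilon>_def)
  have "K x y = 0" if "x \<in> L" "y \<in> L" for x y
  proof -
    obtain X where X: "\<And>n. X n \<in> V (r n)" "X \<longlonglongrightarrow> x" using L(4)[OF \<open>x \<in> L\<close>] by blast
    obtain Y where Y: "\<And>n. Y n \<in> V (r n)" "Y \<longlonglongrightarrow> y" using L(4)[OF \<open>y \<in> L\<close>] by blast
    show ?thesis
      using tendsto_herm_form[OF K X(2) Y(2)] V(3)[OF X(1) Y(1)] by (simp add: LIMSEQ_const_iff)
  qed
  moreover have "0 \<le> Re (H x x)" if "x \<in> L" for x
  proof -
    obtain X where X: "\<And>n. X n \<in> V (r n)" "X \<longlonglongrightarrow> x" using L(4)[OF \<open>x \<in> L\<close>] by blast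
    have "(\<lambda>n. Re (H (X n) (X n) + complex_of_real (\<epsilon> (r n)) * cinner (X n) (X n)))
        \<longlonglongrightarrow> Re (H x x + complex_of_real 0 * cinner x x)"
      by (intro tendsto_intros \<epsilon>r tendsto_herm_form[OF H] tendsto_herm_form[OF herm_form_cinner] X)
    then have "0 \<le> Re (H x x + complex_of_real 0 * cinner x x)"
      by (rule LIMSEQ_le_const) (use V(4)[OF X(1)] in blast)
    then show ?thesis by simp
  qed
  ultimately show ?thesis unfolding isotropic_nonneg_dim_def using L(1,2) by blast
qed

section \<open>Eigenvalues of Hermitian matrices\<close>

lemma sesq_form_eq_cinner: "sesq_form M x y = cinner x (M *v y)"
  by (simp add: sesq_form_def cinner_def)

lemma sesq_form_conj_transpose: "sesq_form (conj_transpose M) x y = cnj (sesq_form M y x)"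
proof -
  have "sesq_form (conj_transpose M) x y =
      (\<Sum>i\<in>UNIV. \<Sum>j\<in>UNIV. cnj (x $ i) * (cnj (M $ j $ i) * y $ j))"
    by (simp add: sesq_form_def matrix_vector_mult_def sum_distrib_left)
  also have "\<dots> = (\<Sum>j\<in>UNIV. \<Sum>i\<in>UNIV. cnj (x $ i) * (cnj (M $ j $ i) * y $ j))"
    by (rule sum.swap)
  also have "\<dots> = cnj (sesq_form M y x)"
    by (simp add: sesq_form_def matrix_vector_mult_def sum_distrib_left mult_ac)
  finally show ?thesis .
qed

lemma sesq_form_right:
  "sesq_form M x (y + z) = sesq_form M x y + sesq_form M x z"
  "sesq_form M x (c *s y) = c * sesq_form M x y"
  by (simp_all add: sesq_form_eq_cinner matrix_vector_right_distrib vec.scale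
      herm_form_simps[OF herm_form_cinner])

lemma herm_form_sesq_form:
  assumes "hermitian M"
  shows "herm_form (sesq_form M)"
proof -
  have "sesq_form M y x = cnj (sesq_form M x y)" for x y
    using sesq_form_conj_transpose[of M y x] assms unfolding hermitian_def by simp
  then show ?thesis unfolding herm_form_def using sesq_form_right by blast
qed

text \<open>The difference of the two sides is orthogonal to every basis vector, hence 0.
  Diagonalising a Hermitian form together with \<open>cinner\<close> is thus the spectral
  theorem.\<close>

lemma eigen_orth_basis:
  assumes B: "orth_basis (sesq_form M) cinner UNIV B" and b: "b \<in> B"
  shows "M *v b = (sesq_form M b b / cinner b b) *s b"
proof -
  let ?z = "M *v b - (sesq_form M b b / cinner b b) *s b"
  have b0: "b \<noteq> 0" using B b vec.dependent_zero[of B] unfolding orth_basis_def by blast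
  have "cinner a ?z = 0" if a: "a \<in> B" for a
  proof -
    have "cinner a ?z + (sesq_form M b b / cinner b b) * cinner a b = sesq_form M a b"
      using herm_form_add_right[OF herm_form_cinner, of a ?z "(sesq_form M b b / cinner b b) *s b"]
      by (simp add: herm_form_scale_right[OF herm_form_cinner] sesq_form_eq_cinner)
    then show ?thesis
      using a b b0 B unfolding orth_basis_def by (cases "a = b") auto
  qed
  moreover have "?z \<in> vec.span B" using B unfolding orth_basis_def by blast
  ultimately have "cinner ?z ?z = 0" by (rule herm_form_eq_0_span_left[OF herm_form_cinner])
  then show ?thesis by simp
qed

section \<open>Counting eigenvalues through the characteristic polynomial\<close>

lemma const_poly_sum: "[:sum f S:] = (\<Sum>x\<in>S. [:f x :: 'a :: comm_ring_1:])"
proof -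
  have "[:a + b:] = [:a:] + [:b :: 'a:]" for a b by simp
  then show ?thesis
    by (induction S rule: infinite_finite_induct) (simp_all del: add_pCons)
qed

lemma const_poly_prod: "[:prod f S:] = (\<Prod>x\<in>S. [:f x :: 'a :: comm_ring_1:])"
proof -
  have "[:a * b:] = [:a:] * [:b :: 'a:]" for a b by simp
  then show ?thesis
    by (induction S rule: infinite_finite_induct)
      (simp_all add: one_pCons del: mult_pCons_left mult_pCons_right)
qed

text \<open>The columns of \<open>Q\<close> are eigenvectors, so \<open>(X - M) Q = Q D\<close> over
  the polynomial ring with \<open>D\<close> diagonal. Taking determinants and cancelling the nonzero
  constant \<open>det Q\<close> avoids inverting \<open>Q\<close>.\<close>

lemma charpoly_eq_prod:
  fixes M Q :: "complex ^ 'n ^ 'n"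
  assumes det: "det Q \<noteq> 0" and eq: "\<And>i j. (M ** Q) $ i $ j = d j * Q $ i $ j"
  shows "charpoly M = (\<Prod>j\<in>UNIV. [:- d j, 1:])"
proof -
  let ?C = "map_matrix (\<lambda>a. [:a:]) :: complex ^ 'n ^ 'n \<Rightarrow> complex poly ^ 'n ^ 'n"
  define X :: "complex poly ^ 'n ^ 'n" where "X = mat [:0, 1:]"
  define D :: "complex poly ^ 'n ^ 'n" where "D = (\<chi> i j. if i = j then [:- d i, 1:] else 0)"
  have "(X - ?C M) ** ?C Q = ?C Q ** D"
  proof -
    have "((X - ?C M) ** ?C Q) $ i $ j = (?C Q ** D) $ i $ j" for i j
    proof -
      have "((X - ?C M) ** ?C Q) $ i $ j =
          (\<Sum>k\<in>UNIV. ((if i = k then [:0, 1:] else 0) - [:M $ i $ k:]) * [:Q $ k $ j:])"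
        by (simp only: matrix_matrix_mult_def X_def mat_def vec_lambda_beta
            vector_minus_component nth_map_matrix)
      also have "\<dots> = (\<Sum>k\<in>UNIV. (if i = k then [:0, 1:] * [:Q $ k $ j:] else 0) - [:M $ i $ k * Q $ k $ j:])"
        by (intro sum.cong) auto
      also have "\<dots> = [:0, 1:] * [:Q $ i $ j:] - [:(M ** Q) $ i $ j:]"
        unfolding sum_subtractf matrix_matrix_mult_def vec_lambda_beta const_poly_sum
        by (subst sum.delta') auto
      also have "\<dots> = [:Q $ i $ j:] * [:- d j, 1:]" unfolding eq by (simp add: algebra_simps)
      also have "\<dots> = (\<Sum>k\<in>UNIV. if k = j then [:Q $ i $ k:] * [:- d k, 1:] else 0)"
        by (subst sum.delta) auto
      also have "\<dots> = (\<Sum>k\<in>UNIV. [:Q $ i $ k:] * (if k = j then [:- d k, 1:] else 0))"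
        by (intro sum.cong) auto
      also have "\<dots> = (?C Q ** D) $ i $ j"
        by (simp only: matrix_matrix_mult_def D_def vec_lambda_beta nth_map_matrix)
      finally show ?thesis .
    qed
    then show ?thesis by (simp add: vec_eq_iff)
  qed
  then have "det (X - ?C M) * det (?C Q) = det (?C Q) * det D" by (metis det_mul)
  moreover have "det (?C Q) = [:det Q:]"
  proof -
    have sgn: "(of_int (sign p) :: complex poly) = [:of_int (sign p):]" for p :: "'n \<Rightarrow> 'n"
      by (simp add: of_int_poly)
    show ?thesis
      unfolding det_def const_poly_sum
      by (intro sum.cong refl) (simp add: sgn mult.commute flip: const_poly_prod)
  qed
  moreover have "[:det Q:] \<noteq> 0" using det by simp
  ultimately have "det (X - ?C M) = det D" by (metis mult.commute mult_left_cancel)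
  also have "det D = (\<Prod>j\<in>UNIV. [:- d j, 1:])"
    by (subst det_diagonal) (simp_all add: D_def)
  finally show ?thesis unfolding charpoly_def X_def .
qed

lemma size_filter_proots_linear_factors:
  "finite S \<Longrightarrow> size (filter_mset P (proots (\<Prod>j\<in>S. [:- d j, 1:] :: complex poly))) = card {j \<in> S. P (d j)}"
proof (induction S rule: finite_induct)
  case empty
  then show ?case by simp
next
  case (insert a S)
  have "(\<Prod>j\<in>S. [:- d j, 1:]) \<noteq> (0 :: complex poly)" using insert by simp
  then have "proots (\<Prod>j\<in>insert a S. [:- d j, 1:]) = {#d a#} + proots (\<Prod>j\<in>S. [:- d j, 1:])"
    using insert by (simp add: proots_mult del: mult_pCons_left)
  moreover have "{j \<in> insert a S. P (d j)} = (if P (d a) then insert a {j \<in> S. P (d j)} else {j \<in> S. P (d j)})"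
    by auto
  ultimately show ?case using insert by simp
qed

text \<open>Links the algebraic count of roots with inertia: the eigenvalue at \<open>b\<close> is
  \<open>sesq_form M b b\<close> divided by the positive number \<open>cinner b b\<close>, so it has
  the same sign.\<close>

lemma num_nonneg_eigenvalues_orth_basis:
  fixes M :: "complex ^ 'n ^ 'n"
  assumes M: "hermitian M" and B: "orth_basis (sesq_form M) cinner UNIV B"
  shows "num_nonneg_eigenvalues M = card {b \<in> B. 0 \<le> Re (sesq_form M b b)}"
proof -
  have F: "herm_form (sesq_form M)" by (rule herm_form_sesq_form[OF M])
  have B': "finite B" "vec.independent B" "vec.span B = UNIV"
    "\<And>a b. a \<in> B \<Longrightarrow> b \<in> B \<Longrightarrow> a \<noteq> b \<Longrightarrow> cinner a b = 0"
    using B unfolding orth_basis_def by blast+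
  have "card B = CARD('n)"
    using vec.dim_span_eq_card_independent[OF B'(2)] unfolding B'(3)
    by (simp add: card_cart_basis)
  then obtain \<phi> :: "'n \<Rightarrow> complex ^ 'n" where \<phi>: "bij_betw \<phi> UNIV B"
    using finite_same_card_bij[of "UNIV :: 'n set" B] B'(1) by auto
  have \<phi>B: "\<phi> j \<in> B" for j using \<phi> bij_betwE by blast
  have ne: "\<phi> j \<noteq> 0" for j using \<phi>B[of j] B'(2) vec.dependent_zero by metis
  define d where "d j = sesq_form M (\<phi> j) (\<phi> j) / cinner (\<phi> j) (\<phi> j)" for j
  define Q :: "complex ^ 'n ^ 'n" where "Q = (\<chi> i j. \<phi> j $ i)"
  have "(M ** Q) $ i $ j = d j * Q $ i $ j" for i j
  proof -
    have "(M ** Q) $ i $ j = (M *v \<phi> j) $ i"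
      by (simp add: Q_def matrix_matrix_mult_def matrix_vector_mult_def)
    then show ?thesis unfolding eigen_orth_basis[OF B \<phi>B] by (simp add: d_def Q_def)
  qed
  moreover have "det Q \<noteq> 0"
  proof -
    \<comment> \<open>The Gram matrix of the orthogonal columns is diagonal with nonzero entries, so
      \<open>Q\<close> is invertible.\<close>
    have entry: "(conj_transpose Q ** Q) $ i $ j = cinner (\<phi> i) (\<phi> j)" for i j
      by (simp add: Q_def matrix_matrix_mult_def cinner_def)
    have "\<phi> i \<noteq> \<phi> j" if "i \<noteq> j" for i j using \<phi> that by (auto simp: bij_betw_def inj_on_def)
    then have "det (conj_transpose Q ** Q) = (\<Prod>i\<in>UNIV. cinner (\<phi> i) (\<phi> i))"
      using B'(4)[OF \<phi>B \<phi>B] by (subst det_diagonal) (simp_all add: entry)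
    also have "\<dots> \<noteq> 0" using ne by simp
    finally show ?thesis by (auto simp: det_mul)
  qed
  ultimately have "charpoly M = (\<Prod>j\<in>UNIV. [:- d j, 1:])" by (intro charpoly_eq_prod)
  then have "num_nonneg_eigenvalues M = card {j. d j \<in> \<real> \<and> 0 \<le> Re (d j)}"
    unfolding num_nonneg_eigenvalues_def eigenvalues_mset_def
    using size_filter_proots_linear_factors[of UNIV "\<lambda>z. z \<in> \<real> \<and> 0 \<le> Re z" d] by simp
  also have "{j. d j \<in> \<real> \<and> 0 \<le> Re (d j)} = {j. 0 \<le> Re (sesq_form M (\<phi> j) (\<phi> j))}"
  proof -
    have "d j = complex_of_real (Re (sesq_form M (\<phi> j) (\<phi> j)) / (norm (\<phi> j))\<^sup>2)" for j
      using herm_form_diag_real[OF F, of "\<phi> j"] herm_form_diag_real[OF herm_form_cinner, of "\<phi> j"]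
      unfolding d_def Re_cinner_self by (metis of_real_divide)
    then have "d j \<in> \<real> \<and> Re (d j) = Re (sesq_form M (\<phi> j) (\<phi> j)) / (norm (\<phi> j))\<^sup>2" for j
      by (metis Reals_of_real Re_complex_of_real)
    then show ?thesis using ne by (simp add: zero_le_divide_iff)
  qed
  also have "card \<dots> = card {b \<in> B. 0 \<le> Re (sesq_form M b b)}"
  proof (rule bij_betw_same_card[of \<phi>])
    show "bij_betw \<phi> {j. 0 \<le> Re (sesq_form M (\<phi> j) (\<phi> j))} {b \<in> B. 0 \<le> Re (sesq_form M b b)}"
      using \<phi> unfolding bij_betw_def by (auto simp: inj_on_def)
  qed
  finally show ?thesis .
qed

lemma eigen_orth_basis_exists:
  assumes "hermitian M"
  obtains B where "orth_basis (sesq_form M) cinner UNIV B"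
  using isotropic_eigenvector_or_orth_basis[OF herm_form_sesq_form[OF assms] herm_form_cinner, of UNIV]
  by auto

lemma num_nonneg_eigenvalues_le_card:
  fixes M :: "complex ^ 'n ^ 'n"
  assumes M: "hermitian M"
  shows "num_nonneg_eigenvalues M \<le> CARD('n)"
proof -
  obtain B where B: "orth_basis (sesq_form M) cinner UNIV B" by (rule eigen_orth_basis_exists[OF M])
  then have B': "finite B" "vec.independent B" unfolding orth_basis_def by blast+
  have "card {b \<in> B. 0 \<le> Re (sesq_form M b b)} \<le> card B"
    using B'(1) by (intro card_mono) auto
  also have "card B \<le> CARD('n)"
    using vec.independent_card_le_dim[of B UNIV] B'(2) by (simp add: card_cart_basis)
  finally show ?thesis unfolding num_nonneg_eigenvalues_orth_basis[OF M B] .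
qed

text \<open>The shift by \<open>e\<close> turns zero eigenvalues into positive ones, so that
  \<open>\<nu>\<close> is captured by strict positivity.\<close>

lemma positive_dim_ge_num_nonneg_eigenvalues:
  fixes M :: "complex ^ 'n ^ 'n"
  assumes M: "hermitian M" and e: "0 < e"
  shows "positive_dim_ge (\<lambda>x y. sesq_form M x y + complex_of_real e * cinner x y) UNIV
    (num_nonneg_eigenvalues M)"
proof -
  obtain B where B: "orth_basis (sesq_form M) cinner UNIV B" by (rule eigen_orth_basis_exists[OF M])
  then have B': "finite B" "vec.independent B" "vec.span B = UNIV"
    "\<And>a b. a \<in> B \<Longrightarrow> b \<in> B \<Longrightarrow> a \<noteq> b \<Longrightarrow> sesq_form M a b + complex_of_real e * cinner a b = 0"
    unfolding orth_basis_def by auto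
  have ne: "b \<noteq> 0" if "b \<in> B" for b using that B'(2) vec.dependent_zero by metis
  have "card {b \<in> B. 0 \<le> Re (sesq_form M b b)} \<le>
      card {b \<in> B. 0 < Re (sesq_form M b b + complex_of_real e * cinner b b)}"
    using B'(1) ne e by (intro card_mono) (auto simp: Re_cinner_self add_nonneg_pos)
  then show ?thesis
    using positive_dim_ge_span_iff[OF herm_form_add_real[OF herm_form_sesq_form[OF M] herm_form_cinner]
        B'(1,2,4)] unfolding B'(3) num_nonneg_eigenvalues_orth_basis[OF M B] by blast
qed

text \<open>The form is negative definite on the span of the basis vectors with negative value, so
  \<open>V\<close> meets that span only in 0 and the dimensions add up to at most
  \<open>n\<close>.\<close>

lemma isotropic_dim_le_num_nonneg_eigenvalues:
  fixes M :: "complex ^ 'n ^ 'n"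
  assumes M: "hermitian M" and V: "vec.subspace V" and iso: "\<And>x. x \<in> V \<Longrightarrow> sesq_form M x x = 0"
  shows "vec.dim V \<le> num_nonneg_eigenvalues M"
proof -
  obtain B where B: "orth_basis (sesq_form M) cinner UNIV B" by (rule eigen_orth_basis_exists[OF M])
  then have B': "finite B" "vec.independent B" "vec.span B = UNIV"
    "\<And>a b. a \<in> B \<Longrightarrow> b \<in> B \<Longrightarrow> a \<noteq> b \<Longrightarrow> sesq_form M a b = 0"
    unfolding orth_basis_def by blast+
  let ?P = "{b \<in> B. 0 \<le> Re (sesq_form M b b)}" and ?N = "{b \<in> B. Re (sesq_form M b b) < 0}"
  have card: "card B = card ?P + card ?N"
    using B'(1) by (subst card_Un_disjoint[symmetric]) (auto intro!: arg_cong[of _ _ card])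
  have "0 < Re (- sesq_form M y y)" if "y \<in> vec.span ?N" "y \<noteq> 0" for y
    using B'(1,4) that
    by (intro herm_form_pos_on_span[OF herm_form_uminus[OF herm_form_sesq_form[OF M]], of ?N y]) auto
  then have "V \<inter> vec.span ?N \<subseteq> {0}" using iso by fastforce
  then have "vec.dim (V \<inter> vec.span ?N) = 0" by (simp only: vec.dim_eq_0)
  moreover have "vec.dim V + vec.dim (vec.span ?N)
      \<le> vec.dim (UNIV :: (complex ^ 'n) set) + vec.dim (V \<inter> vec.span ?N)"
    by (rule dim_Int_ge[OF V]) auto
  moreover have "vec.dim (vec.span ?N) = card ?N"
    by (intro vec.dim_span_eq_card_independent vec.independent_mono[OF B'(2)]) blast
  moreover have "vec.dim (UNIV :: (complex ^ 'n) set) = card B"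
    using vec.dim_span_eq_card_independent[OF B'(2)] unfolding B'(3) .
  ultimately show ?thesis using card unfolding num_nonneg_eigenvalues_orth_basis[OF M B] by linarith
qed

section \<open>Rotations of a matrix\<close>

abbreviation (input) rotation :: "complex ^ 'n ^ 'n \<Rightarrow> real \<Rightarrow> complex ^ 'n ^ 'n" where
  "rotation A \<xi> \<equiv> smult_matrix (exp (\<i> * of_real \<xi>)) A
     + smult_matrix (exp (- \<i> * of_real \<xi>)) (conj_transpose A)"

definition re_form where
  "re_form A x y = sesq_form A x y + cnj (sesq_form A y x)"

definition im_form where
  "im_form A x y = \<i> * (sesq_form A x y - cnj (sesq_form A y x))"

lemma sesq_form_left:
  "sesq_form M (x + y) z = sesq_form M x z + sesq_form M y z"
  "sesq_form M (c *s x) z = cnj c * sesq_form M x z"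
  by (simp_all add: sesq_form_eq_cinner herm_form_simps[OF herm_form_cinner])

lemma herm_form_re_form: "herm_form (re_form A)"
  unfolding herm_form_def re_form_def by (auto simp: sesq_form_left sesq_form_right algebra_simps)

lemma herm_form_im_form: "herm_form (im_form A)"
  unfolding herm_form_def im_form_def by (auto simp: sesq_form_left sesq_form_right algebra_simps)

lemma sesq_form_eq_re_im: "sesq_form A x y = (re_form A x y - \<i> * im_form A x y) / 2"
  by (simp add: re_form_def im_form_def algebra_simps)

lemma sesq_form_rotation:
  "sesq_form (rotation A \<xi>) x y =
     complex_of_real (cos \<xi>) * re_form A x y + complex_of_real (sin \<xi>) * im_form A x y"
proof -
  have smult: "sesq_form (smult_matrix c M) x y = c * sesq_form M x y" for c M
    by (simp add: sesq_form_def matrix_vector_mult_def sum_distrib_left mult_ac)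
  have add: "sesq_form (M + N) x y = sesq_form M x y + sesq_form N x y" for M N
    by (simp add: sesq_form_def matrix_vector_mult_add_rdistrib distrib_left sum.distrib)
  have e: "exp (\<i> * complex_of_real \<xi>) = cos \<xi> + \<i> * sin \<xi>"
    "exp (- \<i> * complex_of_real \<xi>) = cos \<xi> - \<i> * sin \<xi>"
    using cis_conv_exp[of \<xi>] cis_conv_exp[of "- \<xi>"] by (simp_all add: complex_eq_iff)
  show ?thesis
    unfolding add smult sesq_form_conj_transpose e re_form_def im_form_def by (simp add: algebra_simps)
qed

text \<open>Up to a positive factor, \<open>\<sigma> re_form + t im_form\<close> is a rotation with
  cosine of the sign of \<open>\<sigma>\<close>. The two values of \<open>\<sigma>\<close> therefore
  use the two open half circles.\<close>

lemma rotated_forms_isotropic_nonneg: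
  fixes A :: "complex ^ 'n ^ 'n"
  assumes k: "\<And>\<xi>. 0 \<le> \<xi> \<Longrightarrow> \<xi> < 2 * pi \<Longrightarrow> k \<le> num_nonneg_eigenvalues (rotation A \<xi>)"
    and \<sigma>: "\<sigma>\<^sup>2 = 1"
  shows "isotropic_nonneg_dim (\<lambda>x y. complex_of_real \<sigma> * re_form A x y) (im_form A) UNIV k"
proof (rule isotropic_nonneg_dim_limit)
  let ?H = "\<lambda>x y. complex_of_real \<sigma> * re_form A x y"
  show H: "herm_form ?H"
    using herm_form_real_combination[OF herm_form_re_form[of A] herm_form_re_form[of A], of \<sigma> 0] by simp
  show "herm_form (im_form A)" by (rule herm_form_im_form)
  fix e :: real assume e: "0 < e"
  show "isotropic_nonneg_dim (\<lambda>x y. ?H x y + complex_of_real e * cinner x y) (im_form A) UNIV k"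
  proof (rule isotropic_nonneg_subspace_exists[OF herm_form_add_real[OF H herm_form_cinner] herm_form_im_form])
    fix t :: real
    \<comment> \<open>Normalises \<open>(\<sigma>, t)\<close> to a point
      \<open>(cos \<xi>, sin \<xi>)\<close> of the unit circle. Dividing by \<open>s\<close> also
      turns the shift \<open>e\<close> into \<open>e / s\<close>, still positive.\<close>
    define s where "s = sqrt (1 + t\<^sup>2)"
    have s: "0 < s" "s\<^sup>2 = 1 + t\<^sup>2" by (simp_all add: s_def add_pos_nonneg)
    have "(\<sigma> / s)\<^sup>2 + (t / s)\<^sup>2 = 1"
      using s sum_power2_eq_zero_iff[of 1 t] by (simp add: power_divide \<sigma> flip: add_divide_distrib)
    then obtain \<xi> where \<xi>: "0 \<le> \<xi>" "\<xi> < 2 * pi" "\<sigma> / s = cos \<xi>" "t / s = sin \<xi>"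
      by (rule sincos_total_2pi)
    have "positive_dim_ge (\<lambda>x y. sesq_form (rotation A \<xi>) x y + complex_of_real (e / s) * cinner x y)
        UNIV (num_nonneg_eigenvalues (rotation A \<xi>))"
      using e s by (intro positive_dim_ge_num_nonneg_eigenvalues hermitian_rotation) simp
    then obtain P where P: "vec.subspace P" "num_nonneg_eigenvalues (rotation A \<xi>) \<le> vec.dim P"
      "\<And>x. x \<in> P \<Longrightarrow> x \<noteq> 0 \<Longrightarrow>
        0 < Re (sesq_form (rotation A \<xi>) x x + complex_of_real (e / s) * cinner x x)"
      unfolding positive_dim_ge_def by blast
    have scale: "Re (?H x x + complex_of_real e * cinner x x + complex_of_real t * im_form A x x) =
        s * Re (sesq_form (rotation A \<xi>) x x + complex_of_real (e / s) * cinner x x)" for x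
      unfolding sesq_form_rotation \<xi>(3,4)[symmetric] using s(1) by (simp add: field_simps)
    have "0 < Re (?H x x + complex_of_real e * cinner x x + complex_of_real t * im_form A x x)"
      if "x \<in> P" "x \<noteq> 0" for x
      unfolding scale by (rule mult_pos_pos[OF s(1) P(3)[OF that]])
    moreover have "k \<le> vec.dim P" using k[OF \<xi>(1,2)] P(2) by linarith
    ultimately show "positive_dim_ge (\<lambda>x y. ?H x y + complex_of_real e * cinner x y
        + complex_of_real t * im_form A x y) UNIV k"
      unfolding positive_dim_ge_def using P(1) by blast
  qed simp
qed

lemma totally_isotropic_subspace_exists:
  fixes A :: "complex ^ 'n ^ 'n"
  assumes k: "\<And>\<xi>. 0 \<le> \<xi> \<Longrightarrow> \<xi> < 2 * pi \<Longrightarrow> k \<le> num_nonneg_eigenvalues (rotation A \<xi>)"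
  shows "\<exists>V. totally_isotropic_subspace A V \<and> vec.dim V = k"
proof -
  obtain E1 where E1: "vec.subspace E1" "vec.dim E1 = k"
    "\<And>x y. x \<in> E1 \<Longrightarrow> y \<in> E1 \<Longrightarrow> im_form A x y = 0" "\<And>x. x \<in> E1 \<Longrightarrow> 0 \<le> Re (re_form A x x)"
    using rotated_forms_isotropic_nonneg[OF k, of 1] unfolding isotropic_nonneg_dim_def by auto
  obtain E2 where E2: "vec.subspace E2" "vec.dim E2 = k"
    "\<And>x y. x \<in> E2 \<Longrightarrow> y \<in> E2 \<Longrightarrow> im_form A x y = 0" "\<And>x. x \<in> E2 \<Longrightarrow> Re (re_form A x x) \<le> 0"
    using rotated_forms_isotropic_nonneg[OF k, of "-1"] unfolding isotropic_nonneg_dim_def by auto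
  obtain V where V: "vec.subspace V" "vec.dim V = k"
    "\<And>x y. x \<in> V \<Longrightarrow> y \<in> V \<Longrightarrow> re_form A x y = 0 \<and> im_form A x y = 0"
    using semidefinite_pair_isotropic_subspace[OF herm_form_re_form herm_form_im_form
        E1(1) E2(1) E1(2) E2(2) E1(3) E2(3) E1(4) E2(4)] by blast
  have "totally_isotropic_subspace A V"
    unfolding totally_isotropic_subspace_def using V(1,3) by (simp add: sesq_form_eq_re_im)
  then show ?thesis using V(2) by blast
qed

lemma totally_isotropic_dim_le:
  assumes "totally_isotropic_subspace A V"
  shows "vec.dim V \<le> num_nonneg_eigenvalues (rotation A \<xi>)"
proof (rule isotropic_dim_le_num_nonneg_eigenvalues[OF hermitian_rotation])
  show "vec.subspace V" using assms unfolding totally_isotropic_subspace_def by blast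
  show "sesq_form (rotation A \<xi>) x x = 0" if "x \<in> V" for x
    using assms that unfolding totally_isotropic_subspace_def sesq_form_rotation re_form_def im_form_def
    by simp
qed

theorem theorem3p1:
  fixes A :: "complex ^ 'n ^ 'n"
  shows "Min {num_nonneg_eigenvalues
                (smult_matrix (exp (\<i> * of_real \<xi>)) A
                 + smult_matrix (exp (- \<i> * of_real \<xi>)) (conj_transpose A)) |
              \<xi> :: real. \<xi> \<in> {0..<2 * pi}}
       = Max {vec.dim V | V :: (complex ^ 'n) set. totally_isotropic_subspace A V}"
    (is "Min ?S = Max ?T")
proof (rule antisym)
  \<comment> \<open>\<open>Min\<close> and \<open>Max\<close> have their intended meaning only on
    finite nonempty sets; here all values are bounded by the size of the matrix.\<close>
  have "?S \<subseteq> {..CARD('n)}"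
    using num_nonneg_eigenvalues_le_card[OF hermitian_rotation] by blast
  then have S: "finite ?S" by (rule finite_subset) simp
  have S_ne: "?S \<noteq> {}" using pi_gt_zero by (auto intro!: exI[of _ 0])
  have "?T \<subseteq> {..CARD('n)}"
    using vec.dim_subset_UNIV by (auto simp: vec.dimension_def card_cart_basis)
  then have T: "finite ?T" by (rule finite_subset) simp
  have le: "Min ?S \<le> num_nonneg_eigenvalues (rotation A \<xi>)" if "0 \<le> \<xi>" "\<xi> < 2 * pi" for \<xi>
    using that by (intro Min_le[OF S]) auto
  have "\<exists>V. totally_isotropic_subspace A V \<and> vec.dim V = Min ?S"
    by (rule totally_isotropic_subspace_exists) (rule le)
  then obtain V where V: "totally_isotropic_subspace A V" "vec.dim V = Min ?S" by (elim exE conjE)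
  \<comment> \<open>A subspace of dimension exactly \<open>Min ?S\<close> yields one inequality and
    also shows that \<open>?T\<close> is nonempty, as needed for the other.\<close>
  then have MinS: "Min ?S \<in> ?T" by (intro CollectI exI[of _ V]) simp
  then show "Min ?S \<le> Max ?T" by (rule Max_ge[OF T])
  show "Max ?T \<le> Min ?S"
  proof (rule Max.boundedI[OF T])
    show "?T \<noteq> {}" using MinS by blast
    show "d \<le> Min ?S" if "d \<in> ?T" for d
      using that totally_isotropic_dim_le by (intro Min.boundedI[OF S S_ne]) blast
  qed
qed

end
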